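(* Let $Q$ be a measurable complete cone and $X$ a measurable space. For any measurable path $\gamma$ of arity $1$ in the cone $Q\Rightarrow\mathcal M(X)$ with values in its unit ball, there is a measurable stable (in fact linear) function $\hat\gamma$ from $\mathcal M(\mathbb R)$ to $Q\Rightarrow\mathcal M(X)$ such that $\hat\gamma\circ\delta=\gamma$, where $\delta(r)=\delta_r$ is the Dirac measure. It is given by $\hat\gamma(\mu)(y)(U)=\int\gamma(r)(y)(U)\,\mu(dr)$ for $\mu\in\mathcal M(\mathbb R)$, $y\in Q$, $U\in\Sigma_X$.
   Context: Cones: $\mathbb R_{\ge0}$-semimodules $P$ with $\|\cdot\|_P$ satisfying cancellation, $\|\alpha x\|=\alpha\|x\|$, $\|x\|=0\Rightarrow x=0$, triangle inequality and $\|x\|\le\|x+x'\|$; unit ball $\mathcal B P$; order $x\le x'$ iff $x'=x+y$; complete if non-decreasing sequences in $\mathcal B P$ have lubs in $\mathcal B P$. $f:\mathcal B P\to Q$ is pre-stable if $\sum_{I:\,n-|I|\text{ odd}}f(x+\sum_{i\in I}u_i)\le\sum_{I:\,n-|I|\text{ even}}f(x+\sum_{i\in I}u_i)$ (sums over $I\subseteq\{1..n\}$) for all $n\ge1$, $\vec u\in P^n$, $x$ with $x+\sum u_i\in\mathcal B P$; stable if moreover bounded, non-decreasing and preserving lubs of non-decreasing sequences. A measurable cone has sets $\mathcal M_n(P)$ of maps $l$ from $\mathbb R^n$ to linear Scott-continuous maps $P\to\mathbb R_{\ge0}$, containing $0$, closed under precomposition with measurable $h:\mathbb R^p\to\mathbb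 R^n$, with $\vec r\mapsto l(\vec r)(x)$ measurable. A measurable path of arity $n$ is $\gamma:\mathbb R^n\to P$ with bounded image such that $(\vec r,\vec s)\mapsto l(\vec r)(\gamma(\vec s))$ is measurable for all $l\in\mathcal M_k(P)$, all $k$. A stable $f$ is measurable if $f\circ\gamma$ is a measurable path for each measurable path $\gamma$ with values in $\mathcal B P$. $\mathcal M(X)$ is the cone of finite measures on $X$ with pointwise operations, norm $\mu(X)$ and tests $\mathcal M_n(\mathcal M(X))=\{\vec r\mapsto(\mu\mapsto\mu(U)):U\in\Sigma_X\}$. $Q\Rightarrow\mathcal M(X)$: functions $f:\mathcal B Q\to\mathcal M(X)$ with $\epsilon f$ measurable stable and $\epsilon f(\mathcal B Q)\subseteq\mathcal B\mathcal M(X)$ for some $\epsilon>0$; pointwise operations; norm $\sup_{y\in\mathcal BQ}\|f(y)\|$; tests $\vec r\mapsto(f\mapsto m(\vec r)(f(\eta(\vec r))))$ for $\eta$ a measurable path of arity $n$ in $Q$ with values in $\mathcal B Q$ and $m\in\mathcal M_n(\mathcal M(X))$. *)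

theory Defs
  imports "HOL-Algebra.Module" "HOL-Probability.Giry_Monad"
begin

section \<open>Cones\<close>

text \<open>
  The record extends the library's module record in order to reuse its addition, its scalar
  multiplication and the finite sums of abelian monoids. The inherited fields for ring
  multiplication and unit play no role. Scalars are real numbers, and only the nonnegative ones
  are ever used.
\<close>

record 'a normed_cone = "(real, 'a) module" +
  cone_norm :: "'a \<Rightarrow> real"

text \<open>The order of a cone: \<open>x \<le> x'\<close> iff \<open>x' = x + y\<close> for some \<open>y\<close> of the cone.\<close>

definition cone_order :: "('a, 'm) normed_cone_scheme \<Rightarrow> 'a gorder" where
  "cone_order P =
     \<lparr> carrier = carrier P, eq = (=), le = (\<lambda>x x'. \<exists>y\<in>carrier P. x' = x \<oplus>\<^bsub>P\<^esub> y) \<rparr>"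

abbreviation cone_le :: "'a \<Rightarrow> ('a, 'm) normed_cone_scheme \<Rightarrow> 'a \<Rightarrow> bool"
    (\<open>(_/ \<le>\<^bsub>_\<^esub> _)\<close> [51, 0, 51] 50) where
  "x \<le>\<^bsub>P\<^esub> y \<equiv> x \<sqsubseteq>\<^bsub>cone_order P\<^esub> y"

abbreviation cone_lub :: "('a, 'm) normed_cone_scheme \<Rightarrow> (nat \<Rightarrow> 'a) \<Rightarrow> 'a \<Rightarrow> bool" where
  "cone_lub P s x \<equiv> is_lub (cone_order P) x (range s)"

definition unit_ball :: "('a, 'm) normed_cone_scheme \<Rightarrow> 'a set" where
  "unit_ball P = {x \<in> carrier P. cone_norm P x \<le> 1}"

definition cone_incseq :: "('a, 'm) normed_cone_scheme \<Rightarrow> (nat \<Rightarrow> 'a) \<Rightarrow> bool" where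
  "cone_incseq P s \<longleftrightarrow> range s \<subseteq> carrier P \<and> (\<forall>n. s n \<le>\<^bsub>P\<^esub> s (Suc n))"

locale normed_cone = abelian_monoid P for P :: "('a, 'm) normed_cone_scheme" (structure) +
  assumes smult_closed: "\<lbrakk> 0 \<le> a; x \<in> carrier P \<rbrakk> \<Longrightarrow> a \<odot> x \<in> carrier P"
    and smult_l_distr:
      "\<lbrakk> 0 \<le> a; 0 \<le> b; x \<in> carrier P \<rbrakk> \<Longrightarrow> (a + b) \<odot> x = a \<odot> x \<oplus> b \<odot> x"
    and smult_r_distr:
      "\<lbrakk> 0 \<le> a; x \<in> carrier P; y \<in> carrier P \<rbrakk> \<Longrightarrow> a \<odot> (x \<oplus> y) = a \<odot> x \<oplus> a \<odot> y"
    and smult_assoc: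
      "\<lbrakk> 0 \<le> a; 0 \<le> b; x \<in> carrier P \<rbrakk> \<Longrightarrow> (a * b) \<odot> x = a \<odot> (b \<odot> x)"
    and smult_one: "x \<in> carrier P \<Longrightarrow> 1 \<odot> x = x"
    and smult_l_null: "x \<in> carrier P \<Longrightarrow> 0 \<odot> x = \<zero>"
    and smult_r_null: "0 \<le> a \<Longrightarrow> a \<odot> \<zero> = \<zero>"
    and cancel:
      "\<lbrakk> x \<in> carrier P; y \<in> carrier P; y' \<in> carrier P; x \<oplus> y = x \<oplus> y' \<rbrakk> \<Longrightarrow> y = y'"
    and norm_nonneg: "x \<in> carrier P \<Longrightarrow> 0 \<le> cone_norm P x"
    and norm_smult: "\<lbrakk> 0 \<le> a; x \<in> carrier P \<rbrakk> \<Longrightarrow> cone_norm P (a \<odot> x) = a * cone_norm P x"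
    and norm_eq_zero: "\<lbrakk> x \<in> carrier P; cone_norm P x = 0 \<rbrakk> \<Longrightarrow> x = \<zero>"
    and norm_triangle:
      "\<lbrakk> x \<in> carrier P; y \<in> carrier P \<rbrakk> \<Longrightarrow> cone_norm P (x \<oplus> y) \<le> cone_norm P x + cone_norm P y"
    and norm_mono:
      "\<lbrakk> x \<in> carrier P; y \<in> carrier P \<rbrakk> \<Longrightarrow> cone_norm P x \<le> cone_norm P (x \<oplus> y)"

locale complete_cone = normed_cone P for P :: "('a, 'm) normed_cone_scheme" (structure) +
  assumes complete:
    "\<lbrakk> cone_incseq P s; range s \<subseteq> unit_ball P \<rbrakk> \<Longrightarrow> \<exists>x\<in>unit_ball P. cone_lub P s x"

definition nnreal_cone :: "real normed_cone" where
  "nnreal_cone = \<lparr> carrier = {0..}, monoid.mult = (*), one = 1, zero = 0, add = (+), module.smult = (*),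
     cone_norm = (\<lambda>x. x) \<rparr>"


section \<open>Linear, Scott-continuous, pre-stable and stable functions\<close>

definition cone_linear ::
    "('a, 'm) normed_cone_scheme \<Rightarrow> ('b, 'n) normed_cone_scheme \<Rightarrow> ('a \<Rightarrow> 'b) \<Rightarrow> bool" where
  "cone_linear P Q f \<longleftrightarrow>
     f \<in> carrier P \<rightarrow> carrier Q \<and>
     (\<forall>x\<in>carrier P. \<forall>y\<in>carrier P. f (x \<oplus>\<^bsub>P\<^esub> y) = f x \<oplus>\<^bsub>Q\<^esub> f y) \<and>
     (\<forall>a\<ge>0. \<forall>x\<in>carrier P. f (a \<odot>\<^bsub>P\<^esub> x) = a \<odot>\<^bsub>Q\<^esub> f x)"

text \<open>Preservation of the least upper bounds of non-decreasing sequences, for a function on \<open>D\<close>.\<close>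

definition preserves_lubs_on ::
    "'a set \<Rightarrow> ('a, 'm) normed_cone_scheme \<Rightarrow> ('b, 'n) normed_cone_scheme \<Rightarrow> ('a \<Rightarrow> 'b) \<Rightarrow> bool" where
  "preserves_lubs_on D P Q f \<longleftrightarrow>
     (\<forall>s x. cone_incseq P s \<and> range s \<subseteq> D \<and> x \<in> D \<and> cone_lub P s x
        \<longrightarrow> cone_lub Q (\<lambda>n. f (s n)) (f x))"

definition pre_stable ::
    "('a, 'm) normed_cone_scheme \<Rightarrow> ('b, 'n) normed_cone_scheme \<Rightarrow> ('a \<Rightarrow> 'b) \<Rightarrow> bool" where
  "pre_stable P Q f \<longleftrightarrow>
     (\<forall>n\<ge>1. \<forall>u \<in> {1..n} \<rightarrow> carrier P. \<forall>x\<in>carrier P.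
        x \<oplus>\<^bsub>P\<^esub> (\<Oplus>\<^bsub>P\<^esub> i\<in>{1..n}. u i) \<in> unit_ball P \<longrightarrow>
          (\<Oplus>\<^bsub>Q\<^esub> I\<in>{I. I \<subseteq> {1..n} \<and> odd (n - card I)}. f (x \<oplus>\<^bsub>P\<^esub> (\<Oplus>\<^bsub>P\<^esub> i\<in>I. u i)))
          \<le>\<^bsub>Q\<^esub>
          (\<Oplus>\<^bsub>Q\<^esub> I\<in>{I. I \<subseteq> {1..n} \<and> even (n - card I)}. f (x \<oplus>\<^bsub>P\<^esub> (\<Oplus>\<^bsub>P\<^esub> i\<in>I. u i))))"

text \<open>Only the values of \<open>f\<close> on the unit ball of \<open>P\<close> matter for stability.\<close>

definition stable ::
    "('a, 'm) normed_cone_scheme \<Rightarrow> ('b, 'n) normed_cone_scheme \<Rightarrow> ('a \<Rightarrow> 'b) \<Rightarrow> bool" where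
  "stable P Q f \<longleftrightarrow>
     f \<in> unit_ball P \<rightarrow> carrier Q \<and>
     pre_stable P Q f \<and>
     (\<exists>B. \<forall>x\<in>unit_ball P. cone_norm Q (f x) \<le> B) \<and>
     (\<forall>x\<in>unit_ball P. \<forall>y\<in>unit_ball P. x \<le>\<^bsub>P\<^esub> y \<longrightarrow> f x \<le>\<^bsub>Q\<^esub> f y) \<and>
     preserves_lubs_on (unit_ball P) P Q f"


section \<open>Measurable cones\<close>

text \<open>The measurable space \<open>\<real>\<^sup>n\<close>, for a natural number \<open>n\<close> that may vary.\<close>

abbreviation real_pow :: "nat \<Rightarrow> (nat \<Rightarrow> real) measure" where
  "real_pow n \<equiv> \<Pi>\<^sub>M i\<in>{..<n}. (borel :: real measure)"

text \<open>
  \<open>tests P n\<close> is the set of measurability tests of arity \<open>n\<close>. A test is a total function of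
  type \<open>(nat \<Rightarrow> real) \<Rightarrow> 'a \<Rightarrow> real\<close>, whose values outside \<open>\<real>\<^sup>n\<close> and outside the carrier of \<open>P\<close>
  are irrelevant.
\<close>

record 'a measurable_cone = "'a normed_cone" +
  tests :: "nat \<Rightarrow> ((nat \<Rightarrow> real) \<Rightarrow> 'a \<Rightarrow> real) set"

locale measurable_cone = normed_cone P for P :: "('a, 'm) measurable_cone_scheme" (structure) +
  assumes tests_linear:
      "\<lbrakk> l \<in> tests P n; r \<in> space (real_pow n) \<rbrakk> \<Longrightarrow> cone_linear P nnreal_cone (l r)"
    and tests_Scott:
      "\<lbrakk> l \<in> tests P n; r \<in> space (real_pow n) \<rbrakk> \<Longrightarrow>
         preserves_lubs_on (carrier P) P nnreal_cone (l r)"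
    and tests_zero: "(\<lambda>r x. 0) \<in> tests P n"
    and tests_comp:
      "\<lbrakk> l \<in> tests P n; h \<in> real_pow p \<rightarrow>\<^sub>M real_pow n \<rbrakk> \<Longrightarrow> (\<lambda>r. l (h r)) \<in> tests P p"
    and tests_measurable:
      "\<lbrakk> l \<in> tests P n; x \<in> carrier P \<rbrakk> \<Longrightarrow> (\<lambda>r. l r x) \<in> borel_measurable (real_pow n)"

definition measurable_path ::
    "('a, 'm) measurable_cone_scheme \<Rightarrow> nat \<Rightarrow> ((nat \<Rightarrow> real) \<Rightarrow> 'a) \<Rightarrow> bool" where
  "measurable_path P n \<gamma> \<longleftrightarrow>
     \<gamma> \<in> space (real_pow n) \<rightarrow> carrier P \<and>
     (\<exists>B. \<forall>s\<in>space (real_pow n). cone_norm P (\<gamma> s) \<le> B) \<and>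
     (\<forall>k. \<forall>l\<in>tests P k.
        (\<lambda>(r, s). l r (\<gamma> s)) \<in> borel_measurable (real_pow k \<Otimes>\<^sub>M real_pow n))"

definition ball_path ::
    "('a, 'm) measurable_cone_scheme \<Rightarrow> nat \<Rightarrow> ((nat \<Rightarrow> real) \<Rightarrow> 'a) \<Rightarrow> bool" where
  "ball_path P n \<gamma> \<longleftrightarrow> measurable_path P n \<gamma> \<and> \<gamma> \<in> space (real_pow n) \<rightarrow> unit_ball P"

definition measurable_stable ::
    "('a, 'm) measurable_cone_scheme \<Rightarrow> ('b, 'n) measurable_cone_scheme \<Rightarrow> ('a \<Rightarrow> 'b) \<Rightarrow> bool" where
  "measurable_stable P Q f \<longleftrightarrow>
     stable P Q f \<and> (\<forall>n \<gamma>. ball_path P n \<gamma> \<longrightarrow> measurable_path Q n (\<lambda>r. f (\<gamma> r)))"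


section \<open>The cone of finite measures\<close>

definition measure_cone :: "'x measure \<Rightarrow> 'x measure measurable_cone" where
  "measure_cone X = \<lparr>
     carrier = {\<mu>. sets \<mu> = sets X \<and> finite_measure \<mu>},
     monoid.mult = undefined, one = undefined,
     zero = null_measure X,
     add = (\<lambda>\<mu> \<nu>. measure_of (space X) (sets X) (\<lambda>U. emeasure \<mu> U + emeasure \<nu> U)),
     module.smult = (\<lambda>a \<mu>. scale_measure (ennreal a) \<mu>),
     cone_norm = (\<lambda>\<mu>. measure \<mu> (space X)),
     tests = (\<lambda>n. {\<lambda>r \<mu>. measure \<mu> U | U. U \<in> sets X}) \<rparr>"


section \<open>The cone of measurable stable functions\<close>

text \<open>
  A function defined on the unit ball of \<open>P\<close> is represented by a HOL function that takes the
  fixed value \<open>undefined\<close> outside of it, so that equality in the function cone is equality on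
  the ball.
\<close>

definition stable_fun_cone ::
    "('a, 'm) measurable_cone_scheme \<Rightarrow> ('b, 'n) measurable_cone_scheme \<Rightarrow>
     ('a \<Rightarrow> 'b) measurable_cone" where
  "stable_fun_cone P Q = \<lparr>
     carrier = {f \<in> unit_ball P \<rightarrow>\<^sub>E carrier Q.
       \<exists>\<epsilon>>0. measurable_stable P Q (\<lambda>y. \<epsilon> \<odot>\<^bsub>Q\<^esub> f y) \<and>
             (\<forall>y\<in>unit_ball P. \<epsilon> \<odot>\<^bsub>Q\<^esub> f y \<in> unit_ball Q)},
     monoid.mult = undefined, one = undefined,
     zero = (\<lambda>y\<in>unit_ball P. \<zero>\<^bsub>Q\<^esub>),
     add = (\<lambda>f g. \<lambda>y\<in>unit_ball P. f y \<oplus>\<^bsub>Q\<^esub> g y),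
     module.smult = (\<lambda>a f. \<lambda>y\<in>unit_ball P. a \<odot>\<^bsub>Q\<^esub> f y),
     cone_norm = (\<lambda>f. SUP y\<in>unit_ball P. cone_norm Q (f y)),
     tests = (\<lambda>n. {\<lambda>r f. m r (f (\<eta> r)) | \<eta> m. ball_path P n \<eta> \<and> m \<in> tests Q n}) \<rparr>"

end

theory Submission
  imports Defs
begin

text \<open>
  All conditions on a map \<open>f\<close> into finite measures (stability, measurability along paths, and even
  the cone order) can be tested on the real functions \<open>y \<mapsto> f y U\<close>, one for each measurable set
  \<open>U\<close>, and for real functions they are preserved by integration over a parameter. So integrating
  \<open>\<gamma>\<close> against \<open>\<mu>\<close> gives an element of the function cone, and the result is linear in \<open>\<mu>\<close>.

  A linear function is pre-stable and increasing, because the alternating sum of an affine function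
  over a cube is nonnegative. The delicate point is preservation of least upper bounds, since the
  target carries the stable order: if all \<open>\<integral>\<gamma> d\<mu>\<^sub>n\<close> are below \<open>g\<close> in that order, the differences
  \<open>g - \<integral>\<gamma> d\<mu>\<^sub>n\<close> are stable and decrease to \<open>g - \<integral>\<gamma> d\<mu>\<close>. Pre-stability passes to the limit, whereas
  continuity of the limit follows from that of \<open>g\<close> and \<open>\<integral>\<gamma> d\<mu>\<close> separately.
\<close>

section \<open>The cone of finite measures\<close>

lemma mem_carrier_measure_cone:
  "\<mu> \<in> carrier (measure_cone X) \<longleftrightarrow> sets \<mu> = sets X \<and> finite_measure \<mu>"
  by (simp add: measure_cone_def)

lemma zero_measure_cone: "\<zero>\<^bsub>measure_cone X\<^esub> = null_measure X"
  by (simp add: measure_cone_def)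

lemma smult_measure_cone: "a \<odot>\<^bsub>measure_cone X\<^esub> \<mu> = scale_measure (ennreal a) \<mu>"
  by (simp add: measure_cone_def)

lemma norm_measure_cone: "cone_norm (measure_cone X) \<mu> = measure \<mu> (space X)"
  by (simp add: measure_cone_def)

lemma tests_measure_cone: "tests (measure_cone X) n = {\<lambda>r \<mu>. measure \<mu> U | U. U \<in> sets X}"
  by (simp add: measure_cone_def)

lemma sets_add_measure_cone: "sets (\<mu> \<oplus>\<^bsub>measure_cone X\<^esub> \<nu>) = sets X"
  by (simp add: measure_cone_def)

text \<open>\<open>measure_of\<close> returns the intended values only for a countably additive set
  function; here two nonnegative series are added termwise.\<close>

lemma emeasure_add_measure_cone:
  assumes "sets \<mu> = sets X" "sets \<nu> = sets X" "U \<in> sets X"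
  shows "emeasure (\<mu> \<oplus>\<^bsub>measure_cone X\<^esub> \<nu>) U = emeasure \<mu> U + emeasure \<nu> U"
proof -
  have "countably_additive (sets X) (\<lambda>U. emeasure \<mu> U + emeasure \<nu> U)"
  proof (rule countably_additiveI)
    fix A :: "nat \<Rightarrow> _"
    assume "range A \<subseteq> sets X" "disjoint_family A"
    then show "(\<Sum>i. emeasure \<mu> (A i) + emeasure \<nu> (A i)) = emeasure \<mu> (\<Union>i. A i) + emeasure \<nu> (\<Union>i. A i)"
      using assms by (simp add: suminf_add[symmetric] suminf_emeasure)
  qed
  then show ?thesis
    using assms(3)
    by (simp add: measure_cone_def emeasure_measure_of_sigma positive_def sets.sigma_algebra_axioms)
qed

lemma add_measure_cone_closed:
  assumes "\<mu> \<in> carrier (measure_cone X)" "\<nu> \<in> carrier (measure_cone X)"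
  shows "\<mu> \<oplus>\<^bsub>measure_cone X\<^esub> \<nu> \<in> carrier (measure_cone X)"
proof -
  have s: "sets \<mu> = sets X" "sets \<nu> = sets X" and f: "finite_measure \<mu>" "finite_measure \<nu>"
    using assms by (auto simp: mem_carrier_measure_cone)
  have sp: "space (\<mu> \<oplus>\<^bsub>measure_cone X\<^esub> \<nu>) = space X"
    by (simp add: measure_cone_def)
  have "finite_measure (\<mu> \<oplus>\<^bsub>measure_cone X\<^esub> \<nu>)"
    by (rule finite_measureI)
       (simp add: sp emeasure_add_measure_cone[OF s] finite_measure.emeasure_finite[OF f(1)]
          finite_measure.emeasure_finite[OF f(2)])
  then show ?thesis
    by (simp add: mem_carrier_measure_cone sets_add_measure_cone)
qed

lemma measure_add_measure_cone:
  assumes "\<mu> \<in> carrier (measure_cone X)" "\<nu> \<in> carrier (measure_cone X)" "U \<in> sets X"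
  shows "measure (\<mu> \<oplus>\<^bsub>measure_cone X\<^esub> \<nu>) U = measure \<mu> U + measure \<nu> U"
proof -
  have s: "sets \<mu> = sets X" "sets \<nu> = sets X" and f: "finite_measure \<mu>" "finite_measure \<nu>"
    using assms by (auto simp: mem_carrier_measure_cone)
  interpret \<mu>: finite_measure \<mu> by (fact f)
  interpret \<nu>: finite_measure \<nu> by (fact f)
  show ?thesis
    unfolding measure_def emeasure_add_measure_cone[OF s assms(3)]
    by (simp add: enn2real_plus less_top[symmetric])
qed

text \<open>Finiteness lets the real-valued \<open>measure\<close> determine the measure, so that
  later identities live in the reals, where cancellation holds.\<close>

lemma measure_cone_eqI:
  assumes "\<mu> \<in> carrier (measure_cone X)" "\<nu> \<in> carrier (measure_cone X)"
    and "\<And>U. U \<in> sets X \<Longrightarrow> measure \<mu> U = measure \<nu> U"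
  shows "\<mu> = \<nu>"
proof -
  interpret \<mu>: finite_measure \<mu> using assms by (simp add: mem_carrier_measure_cone)
  interpret \<nu>: finite_measure \<nu> using assms by (simp add: mem_carrier_measure_cone)
  show ?thesis
    using assms
    by (intro measure_eqI)
       (auto simp: mem_carrier_measure_cone \<mu>.emeasure_eq_measure \<nu>.emeasure_eq_measure)
qed

lemma zero_measure_cone_closed: "\<zero>\<^bsub>measure_cone X\<^esub> \<in> carrier (measure_cone X)"
  by (auto simp: mem_carrier_measure_cone zero_measure_cone intro!: finite_measureI)

lemma measure_zero_measure_cone: "measure (\<zero>\<^bsub>measure_cone X\<^esub>) U = 0"
  by (simp add: zero_measure_cone measure_def)

lemma smult_measure_cone_closed:
  assumes "\<mu> \<in> carrier (measure_cone X)"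
  shows "a \<odot>\<^bsub>measure_cone X\<^esub> \<mu> \<in> carrier (measure_cone X)"
proof -
  interpret \<mu>: finite_measure \<mu> using assms by (simp add: mem_carrier_measure_cone)
  show ?thesis
    using assms
    by (auto simp: mem_carrier_measure_cone smult_measure_cone space_scale_measure ennreal_mult_eq_top_iff
      intro!: finite_measureI)
qed

lemma measure_smult_measure_cone:
  "0 \<le> a \<Longrightarrow> measure (a \<odot>\<^bsub>measure_cone X\<^esub> \<mu>) U = a * measure \<mu> U"
  by (simp add: smult_measure_cone)

lemma abelian_monoid_measure_cone: "abelian_monoid (measure_cone X)"
  by (rule abelian_monoidI)
     (auto intro!: measure_cone_eqI[where X = X]
       simp: add_measure_cone_closed zero_measure_cone_closed measure_add_measure_cone
         measure_zero_measure_cone)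

lemma normed_cone_measure_cone: "normed_cone (measure_cone X)"
proof -
  interpret abelian_monoid "measure_cone X" by (rule abelian_monoid_measure_cone)
  have bounded: "measure \<mu> U \<le> measure \<mu> (space X)" if "\<mu> \<in> carrier (measure_cone X)" for \<mu> U
  proof -
    have "finite_measure \<mu>" "space \<mu> = space X"
      using that sets_eq_imp_space_eq[of \<mu> X] by (auto simp: mem_carrier_measure_cone)
    then show ?thesis
      using finite_measure.bounded_measure[of \<mu> U] by simp
  qed
  show ?thesis
  proof unfold_locales
    fix x y y'
    assume *: "x \<in> carrier (measure_cone X)" "y \<in> carrier (measure_cone X)" "y' \<in> carrier (measure_cone X)"
      "x \<oplus>\<^bsub>measure_cone X\<^esub> y = x \<oplus>\<^bsub>measure_cone X\<^esub> y'"
    show "y = y'"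
    proof (rule measure_cone_eqI[OF *(2,3)])
      show "measure y U = measure y' U" if "U \<in> sets X" for U
        using measure_add_measure_cone[OF *(1,2) that] measure_add_measure_cone[OF *(1,3) that] *(4) by simp
    qed
  next
    fix x assume *: "x \<in> carrier (measure_cone X)" "cone_norm (measure_cone X) x = 0"
    show "x = \<zero>\<^bsub>measure_cone X\<^esub>"
    proof (rule measure_cone_eqI[OF *(1) zero_measure_cone_closed])
      show "measure x U = measure (\<zero>\<^bsub>measure_cone X\<^esub>) U" if "U \<in> sets X" for U
        using bounded[OF *(1), of U] *(2)
        by (simp add: norm_measure_cone measure_zero_measure_cone order_antisym)
    qed
  qed (auto intro!: measure_cone_eqI[where X = X]
      simp: smult_measure_cone_closed add_measure_cone_closed measure_add_measure_cone measure_smult_measure_cone measure_zero_measure_cone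
        norm_measure_cone algebra_simps)
qed

text \<open>Turns the finite sums in the pre-stability inequality into sums of real numbers, one
  measurable set at a time.\<close>

lemma finsum_measure_cone:
  assumes "finite A" "\<And>i. i \<in> A \<Longrightarrow> f i \<in> carrier (measure_cone X)"
  shows finsum_measure_cone_closed: "(\<Oplus>\<^bsub>measure_cone X\<^esub>i\<in>A. f i) \<in> carrier (measure_cone X)"
    and measure_finsum_measure_cone:
      "U \<in> sets X \<Longrightarrow> measure (\<Oplus>\<^bsub>measure_cone X\<^esub>i\<in>A. f i) U = (\<Sum>i\<in>A. measure (f i) U)"
proof -
  interpret abelian_monoid "measure_cone X" by (rule abelian_monoid_measure_cone)
  show "(\<Oplus>\<^bsub>measure_cone X\<^esub>i\<in>A. f i) \<in> carrier (measure_cone X)"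
    using assms by (intro finsum_closed) auto
  show "measure (\<Oplus>\<^bsub>measure_cone X\<^esub>i\<in>A. f i) U = (\<Sum>i\<in>A. measure (f i) U)" if "U \<in> sets X"
    using assms
  proof (induction rule: finite_induct)
    case (insert i A)
    then have "f \<in> A \<rightarrow> carrier (measure_cone X)" by auto
    with insert that show ?case
      by (simp add: finsum_insert measure_add_measure_cone)
  qed (simp add: measure_zero_measure_cone)
qed

section \<open>Order, monotone limits and paths of finite measures\<close>

lemma cone_le_iff: "x \<le>\<^bsub>P\<^esub> x' \<longleftrightarrow> (\<exists>y\<in>carrier P. x' = x \<oplus>\<^bsub>P\<^esub> y)"
  by (simp add: cone_order_def)

lemma measure_cone_diff:
  assumes "\<mu> \<in> carrier (measure_cone X)" "\<nu> \<in> carrier (measure_cone X)"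
    and "\<And>U. U \<in> sets X \<Longrightarrow> measure \<mu> U \<le> measure \<nu> U"
  shows diff_measure_closed: "diff_measure \<nu> \<mu> \<in> carrier (measure_cone X)"
    and measure_diff_measure:
      "U \<in> sets X \<Longrightarrow> measure (diff_measure \<nu> \<mu>) U = measure \<nu> U - measure \<mu> U"
proof -
  interpret \<mu>: finite_measure \<mu> using assms by (simp add: mem_carrier_measure_cone)
  interpret \<nu>: finite_measure \<nu> using assms by (simp add: mem_carrier_measure_cone)
  have s: "sets \<mu> = sets X" "sets \<nu> = sets X"
    using assms by (auto simp: mem_carrier_measure_cone)
  have e: "emeasure (diff_measure \<nu> \<mu>) U = ennreal (measure \<nu> U - measure \<mu> U)" if "U \<in> sets X" for U
    using that assms(3)
    by (subst emeasure_diff_measure)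
       (auto simp: s \<mu>.finite_measure_axioms \<nu>.finite_measure_axioms \<mu>.emeasure_eq_measure
         \<nu>.emeasure_eq_measure ennreal_minus)
  show "diff_measure \<nu> \<mu> \<in> carrier (measure_cone X)"
    using s(2) e[OF sets.top] by (auto simp: mem_carrier_measure_cone sets_eq_imp_space_eq[OF s(2)]
      intro!: finite_measureI)
  show "measure (diff_measure \<nu> \<mu>) U = measure \<nu> U - measure \<mu> U" if "U \<in> sets X"
    using e[OF that] assms(3)[OF that] by (simp add: measure_def)
qed

text \<open>The witness of the cone order is \<open>diff_measure \<nu> \<mu>\<close>, again a finite
  measure once \<mu> is dominated on every set.\<close>

lemma measure_cone_le_iff:
  assumes "\<mu> \<in> carrier (measure_cone X)" "\<nu> \<in> carrier (measure_cone X)"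
  shows "\<mu> \<le>\<^bsub>measure_cone X\<^esub> \<nu> \<longleftrightarrow> (\<forall>U\<in>sets X. measure \<mu> U \<le> measure \<nu> U)"
proof
  assume "\<forall>U\<in>sets X. measure \<mu> U \<le> measure \<nu> U"
  note diff = measure_cone_diff[OF assms this[rule_format]]
  have "\<nu> = \<mu> \<oplus>\<^bsub>measure_cone X\<^esub> diff_measure \<nu> \<mu>"
    using assms diff
    by (intro measure_cone_eqI[where X = X])
       (simp_all add: add_measure_cone_closed measure_add_measure_cone)
  with diff(1) show "\<mu> \<le>\<^bsub>measure_cone X\<^esub> \<nu>"
    unfolding cone_le_iff by blast
qed (use assms in \<open>auto simp: cone_le_iff measure_add_measure_cone\<close>)

lemma carrier_cone_order: "carrier (cone_order P) = carrier P"
  by (simp add: cone_order_def)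

text \<open>\<open>Upper\<close> quantifies only over those members of the set that lie in the
  carrier; the hypothesis on the range ensures that every term counts.\<close>

lemma cone_lub_iff:
  assumes "range s \<subseteq> carrier P"
  shows "cone_lub P s x \<longleftrightarrow>
    x \<in> carrier P \<and> (\<forall>n. s n \<le>\<^bsub>P\<^esub> x) \<and>
    (\<forall>z\<in>carrier P. (\<forall>n. s n \<le>\<^bsub>P\<^esub> z) \<longrightarrow> x \<le>\<^bsub>P\<^esub> z)"
proof -
  have "Upper (cone_order P) (range s) = {z \<in> carrier P. \<forall>n. s n \<le>\<^bsub>P\<^esub> z}"
    using assms unfolding Upper_def by (auto simp: cone_order_def image_subset_iff)
  then show ?thesis
    by (simp add: least_def subset_iff carrier_cone_order) blast
qed

text \<open>The setwise supremum is countably additive because suprema of increasing sequences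
  commute with sums of nonnegative series; the bound at the whole space makes it finite.\<close>

lemma measure_cone_bounded_limit:
  assumes s: "range s \<subseteq> carrier (measure_cone X)"
    and mono: "\<And>n U. U \<in> sets X \<Longrightarrow> measure (s n) U \<le> measure (s (Suc n)) U"
    and bound: "\<And>n U. U \<in> sets X \<Longrightarrow> measure (s n) U \<le> measure b U"
  shows "\<exists>\<nu>\<in>carrier (measure_cone X). \<forall>U\<in>sets X. (\<lambda>n. measure (s n) U) \<longlonglongrightarrow> measure \<nu> U"
proof -
  have s': "sets (s n) = sets X" "finite_measure (s n)" for n
    using s by (auto simp: mem_carrier_measure_cone image_subset_iff)
  define \<nu> where "\<nu> = measure_of (space X) (sets X) (\<lambda>U. SUP n. emeasure (s n) U)"
  have inc: "incseq (\<lambda>n. emeasure (s n) U)" if "U \<in> sets X" for U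
    using mono[OF that] s' by (intro incseq_SucI) (simp add: finite_measure.emeasure_eq_measure)
  have "countably_additive (sets X) (\<lambda>U. SUP n. emeasure (s n) U)"
  proof (rule countably_additiveI)
    fix A :: "nat \<Rightarrow> _"
    assume A: "range A \<subseteq> sets X" "disjoint_family A"
    have "(\<Sum>i. SUP n. emeasure (s n) (A i)) = (SUP n. \<Sum>i. emeasure (s n) (A i))"
      using A by (intro ennreal_suminf_SUP_eq inc) auto
    then show "(\<Sum>i. SUP n. emeasure (s n) (A i)) = (SUP n. emeasure (s n) (\<Union>i. A i))"
      using A s' by (simp add: suminf_emeasure)
  qed
  then have e: "emeasure \<nu> U = (SUP n. emeasure (s n) U)" if "U \<in> sets X" for U
    using that unfolding \<nu>_def
    by (simp add: emeasure_measure_of_sigma positive_def sets.sigma_algebra_axioms)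
  have "emeasure \<nu> (space X) \<le> ennreal (measure b (space X))"
    unfolding e[OF sets.top] using s'
    by (intro SUP_least) (simp add: finite_measure.emeasure_eq_measure bound)
  then have fin: "finite_measure \<nu>"
    by (intro finite_measureI) (auto simp: \<nu>_def top_unique)
  moreover have "sets \<nu> = sets X"
    by (simp add: \<nu>_def)
  moreover have "(\<lambda>n. measure (s n) U) \<longlonglongrightarrow> measure \<nu> U" if "U \<in> sets X" for U
  proof -
    have "(\<lambda>n. emeasure (s n) U) \<longlonglongrightarrow> emeasure \<nu> U"
      unfolding e[OF that] by (rule LIMSEQ_SUP[OF inc[OF that]])
    then show ?thesis
      using s' fin by (simp add: finite_measure.emeasure_eq_measure)
  qed
  ultimately show ?thesis
    by (intro bexI[of _ \<nu>]) (auto simp: mem_carrier_measure_cone)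
qed

text \<open>The order is setwise, so a setwise limit is an upper bound and the least one. The
  converse first constructs that limit and then compares it with the given bound.\<close>

lemma cone_lub_measure_cone_iff:
  assumes s: "cone_incseq (measure_cone X) s"
  shows "cone_lub (measure_cone X) s x \<longleftrightarrow>
    x \<in> carrier (measure_cone X) \<and> (\<forall>U\<in>sets X. (\<lambda>n. measure (s n) U) \<longlonglongrightarrow> measure x U)"
proof -
  have c: "range s \<subseteq> carrier (measure_cone X)" and c': "\<And>n. s n \<in> carrier (measure_cone X)"
    using s by (auto simp: cone_incseq_def)
  have inc: "measure (s n) U \<le> measure (s (Suc n)) U" if "U \<in> sets X" for U n
    using s that c' by (simp add: cone_incseq_def measure_cone_le_iff)
  have limit_upper: "s n \<le>\<^bsub>measure_cone X\<^esub> \<nu>"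
    if \<nu>: "\<nu> \<in> carrier (measure_cone X)"
      and lim: "\<forall>U\<in>sets X. (\<lambda>n. measure (s n) U) \<longlonglongrightarrow> measure \<nu> U" for \<nu> n
  proof -
    have "measure (s n) U \<le> measure \<nu> U" if "U \<in> sets X" for U
      using lim that inc[OF that] by (intro incseq_le[of "\<lambda>n. measure (s n) U"]) (auto intro: incseq_SucI)
    then show ?thesis
      using c' \<nu> by (simp add: measure_cone_le_iff)
  qed
  show ?thesis
    unfolding cone_lub_iff[OF c]
  proof (intro iffI conjI ballI allI impI; (elim conjE)?)
    fix U
    assume U: "U \<in> sets X" and x: "x \<in> carrier (measure_cone X)"
      and upper: "\<forall>n. s n \<le>\<^bsub>measure_cone X\<^esub> x"
      and least: "\<forall>z\<in>carrier (measure_cone X). (\<forall>n. s n \<le>\<^bsub>measure_cone X\<^esub> z) \<longrightarrow> x \<le>\<^bsub>measure_cone X\<^esub> z"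
    have b: "measure (s n) V \<le> measure x V" if "V \<in> sets X" for V n
      using upper that x c' by (simp add: measure_cone_le_iff)
    \<comment> \<open>The least upper bound \<open>x\<close> itself bounds the sequence, so the
      setwise limit \<nu> is a finite measure; \<open>x\<close> is below \<nu> by leastness, and
      \<nu> is below \<open>x\<close> by passing to the limit.\<close>
    have "\<exists>\<nu>\<in>carrier (measure_cone X). \<forall>U\<in>sets X. (\<lambda>n. measure (s n) U) \<longlonglongrightarrow> measure \<nu> U"
      by (rule measure_cone_bounded_limit[where b = x, OF c]) (simp_all add: inc b)
    then obtain \<nu> where \<nu>: "\<nu> \<in> carrier (measure_cone X)"
      "\<forall>U\<in>sets X. (\<lambda>n. measure (s n) U) \<longlonglongrightarrow> measure \<nu> U"
      by blast
    with limit_upper least have "x \<le>\<^bsub>measure_cone X\<^esub> \<nu>" by blast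
    then have "measure x U \<le> measure \<nu> U"
      using x \<nu> U by (simp add: measure_cone_le_iff)
    moreover have "measure \<nu> U \<le> measure x U"
      using \<nu>(2)[rule_format, OF U] b[OF U] by (intro LIMSEQ_le_const2) auto
    ultimately show "(\<lambda>n. measure (s n) U) \<longlonglongrightarrow> measure x U"
      using \<nu>(2)[rule_format, OF U] by simp
  next
    fix n
    assume "x \<in> carrier (measure_cone X)" "\<forall>U\<in>sets X. (\<lambda>n. measure (s n) U) \<longlonglongrightarrow> measure x U"
    then show "s n \<le>\<^bsub>measure_cone X\<^esub> x"
      by (rule limit_upper)
  next
    fix z
    assume "x \<in> carrier (measure_cone X)" "\<forall>U\<in>sets X. (\<lambda>n. measure (s n) U) \<longlonglongrightarrow> measure x U"
      "z \<in> carrier (measure_cone X)" "\<forall>n. s n \<le>\<^bsub>measure_cone X\<^esub> z"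
    then show "x \<le>\<^bsub>measure_cone X\<^esub> z"
      using c' by (auto simp: measure_cone_le_iff intro: LIMSEQ_le_const2)
  qed auto
qed

text \<open>The tests of this cone ignore their real parameters, so joint measurability reduces to
  measurability in the path variable alone.\<close>

lemma measurable_path_measure_cone_iff:
  "measurable_path (measure_cone X) n \<gamma> \<longleftrightarrow>
    \<gamma> \<in> space (real_pow n) \<rightarrow> carrier (measure_cone X) \<and>
    (\<exists>B. \<forall>s\<in>space (real_pow n). measure (\<gamma> s) (space X) \<le> B) \<and>
    (\<forall>U\<in>sets X. (\<lambda>s. measure (\<gamma> s) U) \<in> borel_measurable (real_pow n))"
proof -
  have "(\<forall>k. (\<lambda>(r, s). measure (\<gamma> s) U) \<in> borel_measurable (real_pow k \<Otimes>\<^sub>M real_pow n)) \<longleftrightarrow>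
      (\<lambda>s. measure (\<gamma> s) U) \<in> borel_measurable (real_pow n)" (is "?L \<longleftrightarrow> ?R") for U
  proof
    assume ?L
    then have "(\<lambda>(r, s). measure (\<gamma> s) U) \<in> borel_measurable (real_pow 0 \<Otimes>\<^sub>M real_pow n)"
      by blast
    \<comment> \<open>\<open>\<lambda>_. undefined\<close> is the only point of
      \<open>real_pow 0\<close>; fixing the first component there leaves a function of
      \<open>s\<close>.\<close>
    from measurable_Pair2[OF this, of "\<lambda>_. undefined"] show ?R
      by (simp add: space_PiM)
  next
    assume ?R
    then show ?L by simp
  qed
  moreover have "(\<forall>k. \<forall>l\<in>tests (measure_cone X) k. R k l) \<longleftrightarrow>
      (\<forall>U\<in>sets X. \<forall>k. R k (\<lambda>r \<mu>. measure \<mu> U))" for R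
    by (auto simp: tests_measure_cone)
  ultimately show ?thesis
    unfolding measurable_path_def norm_measure_cone by simp
qed

section \<open>Real-valued stable functions\<close>

text \<open>The vertices of a cube with corner \<open>x\<close> and edges \<open>u\<close>, indexed
  by sets of directions. Pre-stability then speaks only of values at vertices and no longer of
  \<open>x\<close> and \<open>u\<close>.\<close>

definition cone_cube :: "('a, 'm) normed_cone_scheme \<Rightarrow> nat \<Rightarrow> (nat set \<Rightarrow> 'a) \<Rightarrow> bool" where
  "cone_cube P n p \<longleftrightarrow>
     (\<exists>u\<in>{1..n} \<rightarrow> carrier P. \<exists>x\<in>carrier P. x \<oplus>\<^bsub>P\<^esub> (\<Oplus>\<^bsub>P\<^esub>i\<in>{1..n}. u i) \<in> unit_ball P \<and>
       p = (\<lambda>I. x \<oplus>\<^bsub>P\<^esub> (\<Oplus>\<^bsub>P\<^esub>i\<in>I. u i)))"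

definition odd_faces :: "nat \<Rightarrow> nat set set" where
  "odd_faces n = {I. I \<subseteq> {1..n} \<and> odd (n - card I)}"

definition even_faces :: "nat \<Rightarrow> nat set set" where
  "even_faces n = {I. I \<subseteq> {1..n} \<and> even (n - card I)}"

lemma finite_faces: "finite (odd_faces n)" "finite (even_faces n)"
  by (auto simp: odd_faces_def even_faces_def)

lemma faces_subset: "I \<in> odd_faces n \<Longrightarrow> I \<subseteq> {1..n}" "I \<in> even_faces n \<Longrightarrow> I \<subseteq> {1..n}"
  by (auto simp: odd_faces_def even_faces_def)

lemma pre_stable_iff:
  "pre_stable P Q f \<longleftrightarrow>
    (\<forall>n\<ge>1. \<forall>p. cone_cube P n p \<longrightarrow>
      (\<Oplus>\<^bsub>Q\<^esub>I\<in>odd_faces n. f (p I)) \<le>\<^bsub>Q\<^esub> (\<Oplus>\<^bsub>Q\<^esub>I\<in>even_faces n. f (p I)))"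
  unfolding pre_stable_def cone_cube_def odd_faces_def even_faces_def by blast

lemma unit_ball_subset: "unit_ball P \<subseteq> carrier P"
  by (auto simp: unit_ball_def)

lemma (in normed_cone) zero_in_unit_ball: "\<zero> \<in> unit_ball P"
  using norm_smult[of 0 \<zero>] smult_r_null[of 0] by (simp add: unit_ball_def)

text \<open>Adding the missing edges to \<open>p I\<close> gives the top vertex, which lies in the
  ball; the norm is monotone under addition.\<close>

lemma (in normed_cone) cone_cube_unit_ball:
  assumes "cone_cube P n p" "I \<subseteq> {1..n}"
  shows "p I \<in> unit_ball P"
proof -
  obtain u x where u: "u \<in> {1..n} \<rightarrow> carrier P" and x: "x \<in> carrier P"
    and b: "x \<oplus> (\<Oplus>i\<in>{1..n}. u i) \<in> unit_ball P" and p: "p = (\<lambda>I. x \<oplus> (\<Oplus>i\<in>I. u i))"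
    using assms(1) by (auto simp: cone_cube_def)
  have u': "u \<in> I \<rightarrow> carrier P" "u \<in> {1..n} - I \<rightarrow> carrier P"
    using u assms(2) by auto
  have "(\<Oplus>i\<in>I \<union> ({1..n} - I). u i) = (\<Oplus>i\<in>I. u i) \<oplus> (\<Oplus>i\<in>{1..n} - I. u i)"
    using u' finite_subset[OF assms(2)] by (intro finsum_Un_disjoint) auto
  moreover have "I \<union> ({1..n} - I) = {1..n}"
    using assms(2) by auto
  ultimately have e: "x \<oplus> (\<Oplus>i\<in>{1..n}. u i) = p I \<oplus> (\<Oplus>i\<in>{1..n} - I. u i)"
    using u' x by (simp add: p a_assoc)
  have c: "p I \<in> carrier P"
    using u' x by (simp add: p)
  with u' have "cone_norm P (p I) \<le> cone_norm P (x \<oplus> (\<Oplus>i\<in>{1..n}. u i))"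
    unfolding e by (intro norm_mono) auto
  with b c show ?thesis
    by (simp add: unit_ball_def)
qed

lemma (in normed_cone) cone_cube_faces:
  assumes "cone_cube P n p"
  shows "I \<in> odd_faces n \<Longrightarrow> p I \<in> unit_ball P" "I \<in> even_faces n \<Longrightarrow> p I \<in> unit_ball P"
  using cone_cube_unit_ball[OF assms] faces_subset by blast+

text \<open>
  The function need not be nonnegative: the order of the function cone is not pointwise, but asks
  for a difference that is itself stable.
\<close>

definition scalar_stable :: "('a, 'm) measurable_cone_scheme \<Rightarrow> ('a \<Rightarrow> real) \<Rightarrow> bool" where
  "scalar_stable P g \<longleftrightarrow>
     (\<forall>n\<ge>1. \<forall>p. cone_cube P n p \<longrightarrow> (\<Sum>I\<in>odd_faces n. g (p I)) \<le> (\<Sum>I\<in>even_faces n. g (p I))) \<and>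
     (\<exists>B. \<forall>x\<in>unit_ball P. \<bar>g x\<bar> \<le> B) \<and>
     (\<forall>x\<in>unit_ball P. \<forall>y\<in>unit_ball P. x \<le>\<^bsub>P\<^esub> y \<longrightarrow> g x \<le> g y) \<and>
     (\<forall>s x. cone_incseq P s \<and> range s \<subseteq> unit_ball P \<and> x \<in> unit_ball P \<and> cone_lub P s x
        \<longrightarrow> (\<lambda>n. g (s n)) \<longlonglongrightarrow> g x) \<and>
     (\<forall>n \<eta>. ball_path P n \<eta> \<longrightarrow> (\<lambda>r. g (\<eta> r)) \<in> borel_measurable (real_pow n))"

section \<open>Rules and closure properties of real-valued stable functions\<close>

lemma scalar_stableD:
  assumes "scalar_stable P g"
  shows scalar_stable_cube:
      "\<And>n p. 1 \<le> n \<Longrightarrow> cone_cube P n p \<Longrightarrow> (\<Sum>I\<in>odd_faces n. g (p I)) \<le> (\<Sum>I\<in>even_faces n. g (p I))"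
    and scalar_stable_bounded: "\<exists>B. \<forall>x\<in>unit_ball P. \<bar>g x\<bar> \<le> B"
    and scalar_stable_mono:
      "\<And>x y. x \<in> unit_ball P \<Longrightarrow> y \<in> unit_ball P \<Longrightarrow> x \<le>\<^bsub>P\<^esub> y \<Longrightarrow> g x \<le> g y"
    and scalar_stable_lub:
      "\<And>s x. cone_incseq P s \<Longrightarrow> range s \<subseteq> unit_ball P \<Longrightarrow> x \<in> unit_ball P \<Longrightarrow> cone_lub P s x \<Longrightarrow>
        (\<lambda>n. g (s n)) \<longlonglongrightarrow> g x"
    and scalar_stable_path:
      "\<And>n \<eta>. ball_path P n \<eta> \<Longrightarrow> (\<lambda>r. g (\<eta> r)) \<in> borel_measurable (real_pow n)"
  using assms unfolding scalar_stable_def by blast+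

lemma scalar_stableI:
  assumes "\<And>n p. 1 \<le> n \<Longrightarrow> cone_cube P n p \<Longrightarrow> (\<Sum>I\<in>odd_faces n. g (p I)) \<le> (\<Sum>I\<in>even_faces n. g (p I))"
    and "\<And>x. x \<in> unit_ball P \<Longrightarrow> \<bar>g x\<bar> \<le> B"
    and "\<And>x y. x \<in> unit_ball P \<Longrightarrow> y \<in> unit_ball P \<Longrightarrow> x \<le>\<^bsub>P\<^esub> y \<Longrightarrow> g x \<le> g y"
    and "\<And>s x. cone_incseq P s \<Longrightarrow> range s \<subseteq> unit_ball P \<Longrightarrow> x \<in> unit_ball P \<Longrightarrow> cone_lub P s x \<Longrightarrow>
        (\<lambda>n. g (s n)) \<longlonglongrightarrow> g x"
    and "\<And>n \<eta>. ball_path P n \<eta> \<Longrightarrow> (\<lambda>r. g (\<eta> r)) \<in> borel_measurable (real_pow n)"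
  shows "scalar_stable P g"
  using assms unfolding scalar_stable_def by blast

lemma ball_path_in_unit_ball: "ball_path P n \<eta> \<Longrightarrow> r \<in> space (real_pow n) \<Longrightarrow> \<eta> r \<in> unit_ball P"
  by (auto simp: ball_path_def)

text \<open>Every clause evaluates the function only inside the unit ball: at vertices of cubes,
  along sequences in the ball and along ball paths.\<close>

lemma scalar_stable_cong:
  assumes "normed_cone P" "\<And>x. x \<in> unit_ball P \<Longrightarrow> f x = g x"
  shows "scalar_stable P f \<longleftrightarrow> scalar_stable P g"
proof -
  interpret normed_cone P by fact
  have *: "scalar_stable P g" if f: "scalar_stable P f" and eq: "\<And>x. x \<in> unit_ball P \<Longrightarrow> f x = g x" for f g
  proof -
    obtain B where "\<And>x. x \<in> unit_ball P \<Longrightarrow> \<bar>f x\<bar> \<le> B"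
      using scalar_stable_bounded[OF f] by blast
    then show ?thesis
    proof (intro scalar_stableI[where B = B])
      fix n p assume "1 \<le> n" and p: "cone_cube P n p"
      have "(\<Sum>I\<in>odd_faces n. g (p I)) = (\<Sum>I\<in>odd_faces n. f (p I))"
        "(\<Sum>I\<in>even_faces n. g (p I)) = (\<Sum>I\<in>even_faces n. f (p I))"
        by (intro sum.cong refl eq[symmetric]; simp add: cone_cube_faces[OF p])+
      then show "(\<Sum>I\<in>odd_faces n. g (p I)) \<le> (\<Sum>I\<in>even_faces n. g (p I))"
        using scalar_stable_cube[OF f \<open>1 \<le> n\<close> p] by simp
    next
      fix n \<eta> assume \<eta>: "ball_path P n \<eta>"
      then show "(\<lambda>r. g (\<eta> r)) \<in> borel_measurable (real_pow n)"
        using scalar_stable_path[OF f \<eta>] by (subst measurable_cong[where g = "\<lambda>r. f (\<eta> r)"])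
           (auto simp: eq ball_path_in_unit_ball)
    qed (use eq scalar_stable_mono[OF f] scalar_stable_lub[OF f] in \<open>auto simp: image_subset_iff\<close>)
  qed
  show ?thesis
    using *[of f g] *[of g f] assms(2) by auto
qed

lemma scalar_stable_zero: "scalar_stable P (\<lambda>x. 0)"
  by (intro scalar_stableI[where B = 0]) auto

lemma scalar_stable_add:
  assumes "scalar_stable P f" "scalar_stable P g"
  shows "scalar_stable P (\<lambda>x. f x + g x)"
proof -
  obtain B where B: "\<And>x. x \<in> unit_ball P \<Longrightarrow> \<bar>f x\<bar> \<le> B"
    using scalar_stable_bounded[OF assms(1)] by blast
  obtain C where C: "\<And>x. x \<in> unit_ball P \<Longrightarrow> \<bar>g x\<bar> \<le> C"
    using scalar_stable_bounded[OF assms(2)] by blast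
  show ?thesis
  proof (intro scalar_stableI[where B = "B + C"])
    show "\<bar>f x + g x\<bar> \<le> B + C" if "x \<in> unit_ball P" for x
      using B[OF that] C[OF that] by linarith
  qed (use scalar_stableD[OF assms(1)] scalar_stableD[OF assms(2)] in
      \<open>auto simp: sum.distrib intro!: add_mono tendsto_add\<close>)
qed

lemma scalar_stable_cmult:
  assumes "scalar_stable P f" "0 \<le> c"
  shows "scalar_stable P (\<lambda>x. c * f x)"
proof -
  obtain B where B: "\<And>x. x \<in> unit_ball P \<Longrightarrow> \<bar>f x\<bar> \<le> B"
    using scalar_stable_bounded[OF assms(1)] by blast
  show ?thesis
  proof (intro scalar_stableI[where B = "c * B"])
    show "\<bar>c * f x\<bar> \<le> c * B" if "x \<in> unit_ball P" for x
      using B[OF that] assms(2) by (simp add: abs_mult mult_left_mono)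
  qed (use scalar_stableD[OF assms(1)] assms(2) in
      \<open>auto simp: sum_distrib_left[symmetric] intro!: mult_left_mono tendsto_mult_left\<close>)
qed

text \<open>Non-strict inequalities survive a pointwise limit, which covers cubes and monotonicity.
  Continuity need not survive it, so that clause is taken from \<open>f\<close> and \<open>g\<close>
  separately, as are the bound and path measurability.\<close>

lemma scalar_stable_diff_limit:
  assumes P: "normed_cone P" and g: "scalar_stable P g" and f: "scalar_stable P f"
    and h: "\<And>k. scalar_stable P (h k)"
    and lim: "\<And>x. x \<in> unit_ball P \<Longrightarrow> (\<lambda>k. h k x) \<longlonglongrightarrow> g x - f x"
  shows "scalar_stable P (\<lambda>x. g x - f x)"
proof -
  interpret normed_cone P by fact
  obtain B where B: "\<And>x. x \<in> unit_ball P \<Longrightarrow> \<bar>f x\<bar> \<le> B"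
    using scalar_stable_bounded[OF f] by blast
  obtain C where C: "\<And>x. x \<in> unit_ball P \<Longrightarrow> \<bar>g x\<bar> \<le> C"
    using scalar_stable_bounded[OF g] by blast
  show ?thesis
  proof (intro scalar_stableI[where B = "B + C"])
    show "\<bar>g x - f x\<bar> \<le> B + C" if "x \<in> unit_ball P" for x
      using B[OF that] C[OF that] by linarith
  next
    fix n p assume n: "1 \<le> n" and p: "cone_cube P n p"
    have "(\<lambda>k. \<Sum>I\<in>odd_faces n. h k (p I)) \<longlonglongrightarrow> (\<Sum>I\<in>odd_faces n. g (p I) - f (p I))"
      "(\<lambda>k. \<Sum>I\<in>even_faces n. h k (p I)) \<longlonglongrightarrow> (\<Sum>I\<in>even_faces n. g (p I) - f (p I))"
      by (intro tendsto_sum lim; simp add: cone_cube_faces[OF p])+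
    then show "(\<Sum>I\<in>odd_faces n. g (p I) - f (p I)) \<le> (\<Sum>I\<in>even_faces n. g (p I) - f (p I))"
      by (rule LIMSEQ_le) (use scalar_stable_cube[OF h n p] in auto)
  next
    fix x y assume "x \<in> unit_ball P" "y \<in> unit_ball P" "x \<le>\<^bsub>P\<^esub> y"
    then show "g x - f x \<le> g y - f y"
      by (intro LIMSEQ_le[OF lim lim]) (use scalar_stable_mono[OF h] in auto)
  qed (use scalar_stable_lub[OF f] scalar_stable_lub[OF g] scalar_stable_path[OF f]
      scalar_stable_path[OF g] in \<open>auto intro!: tendsto_diff\<close>)
qed

text \<open>The inequalities are integrated pointwise. Least upper bounds use dominated convergence,
  where the constant \<open>B\<close> is integrable because \<mu> is finite, and path measurability
  comes from joint measurability of the integrand.\<close>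

lemma scalar_stable_integral:
  assumes P: "normed_cone P" and \<mu>: "finite_measure \<mu>"
    and g: "\<And>t. t \<in> space \<mu> \<Longrightarrow> scalar_stable P (g t)"
    and bound: "\<And>t x. t \<in> space \<mu> \<Longrightarrow> x \<in> unit_ball P \<Longrightarrow> \<bar>g t x\<bar> \<le> B"
    and meas: "\<And>x. x \<in> unit_ball P \<Longrightarrow> (\<lambda>t. g t x) \<in> borel_measurable \<mu>"
    and path: "\<And>n \<eta>. ball_path P n \<eta> \<Longrightarrow>
      (\<lambda>(r, t). g t (\<eta> r)) \<in> borel_measurable (real_pow n \<Otimes>\<^sub>M \<mu>)"
  shows "scalar_stable P (\<lambda>x. \<integral>t. g t x \<partial>\<mu>)"
proof -
  interpret normed_cone P by fact
  interpret \<mu>: finite_measure \<mu> by fact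
  have int: "integrable \<mu> (\<lambda>t. g t x)" if "x \<in> unit_ball P" for x
    using bound that by (intro \<mu>.integrable_const_bound[where B = B] AE_I2 meas) auto
  show ?thesis
  \<comment> \<open>The bound of \<open>scalar_stableI\<close> stays schematic and is fixed by the
    first case as the integral of the constant \<open>B\<close>.\<close>
  proof (intro scalar_stableI)
    fix x assume x: "x \<in> unit_ball P"
    have "\<bar>\<integral>t. g t x \<partial>\<mu>\<bar> \<le> (\<integral>t. \<bar>g t x\<bar> \<partial>\<mu>)"
      by (rule integral_abs_bound)
    also have "\<dots> \<le> (\<integral>t. B \<partial>\<mu>)"
      using int[OF x] bound x by (intro integral_mono) auto
    finally show "\<bar>\<integral>t. g t x \<partial>\<mu>\<bar> \<le> (\<integral>t. B \<partial>\<mu>)" .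
  next
    fix n p assume n: "1 \<le> n" and p: "cone_cube P n p"
    have i: "\<And>I. I \<in> odd_faces n \<Longrightarrow> integrable \<mu> (\<lambda>t. g t (p I))"
      "\<And>I. I \<in> even_faces n \<Longrightarrow> integrable \<mu> (\<lambda>t. g t (p I))"
      by (intro int; simp add: cone_cube_faces[OF p])+
    have "(\<Sum>I\<in>odd_faces n. \<integral>t. g t (p I) \<partial>\<mu>) = (\<integral>t. (\<Sum>I\<in>odd_faces n. g t (p I)) \<partial>\<mu>)"
      using i by (intro Bochner_Integration.integral_sum[symmetric])
    also have "\<dots> \<le> (\<integral>t. (\<Sum>I\<in>even_faces n. g t (p I)) \<partial>\<mu>)"
      using i scalar_stable_cube[OF g n p]
      by (intro integral_mono Bochner_Integration.integrable_sum)
    also have "\<dots> = (\<Sum>I\<in>even_faces n. \<integral>t. g t (p I) \<partial>\<mu>)"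
      using i by (intro Bochner_Integration.integral_sum)
    finally show "(\<Sum>I\<in>odd_faces n. \<integral>t. g t (p I) \<partial>\<mu>) \<le> (\<Sum>I\<in>even_faces n. \<integral>t. g t (p I) \<partial>\<mu>)" .
  next
    fix x y assume "x \<in> unit_ball P" "y \<in> unit_ball P" "x \<le>\<^bsub>P\<^esub> y"
    then show "(\<integral>t. g t x \<partial>\<mu>) \<le> (\<integral>t. g t y \<partial>\<mu>)"
      by (intro integral_mono int scalar_stable_mono[OF g])
  next
    fix s x assume s: "cone_incseq P s" "range s \<subseteq> unit_ball P" "x \<in> unit_ball P" "cone_lub P s x"
    show "(\<lambda>n. \<integral>t. g t (s n) \<partial>\<mu>) \<longlonglongrightarrow> (\<integral>t. g t x \<partial>\<mu>)"
      using s scalar_stable_lub[OF g s] bound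
      by (intro integral_dominated_convergence[where w = "\<lambda>_. B"] meas AE_I2)
         (auto simp: image_subset_iff)
  next
    fix n \<eta> assume \<eta>: "ball_path P n \<eta>"
    show "(\<lambda>r. \<integral>t. g t (\<eta> r) \<partial>\<mu>) \<in> borel_measurable (real_pow n)"
      by (rule \<mu>.borel_measurable_lebesgue_integral[OF path[OF \<eta>]])
  qed
qed

text \<open>Each clause splits into one condition per measurable set, because sums, order, least
  upper bounds and paths of measures are all read setwise.\<close>

lemma measurable_stable_measure_cone_iff:
  assumes "normed_cone P"
  shows "measurable_stable P (measure_cone X) f \<longleftrightarrow>
    f \<in> unit_ball P \<rightarrow> carrier (measure_cone X) \<and>
    (\<forall>U\<in>sets X. scalar_stable P (\<lambda>x. measure (f x) U))"
proof (cases "f \<in> unit_ball P \<rightarrow> carrier (measure_cone X)")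
  case False
  then show ?thesis by (simp add: measurable_stable_def stable_def)
next
  case f: True
  interpret normed_cone P by fact
  have finite_le: "measure (f x) U \<le> measure (f x) (space X)"
    if "x \<in> unit_ball P" "U \<in> sets X" for x U
  proof -
    have "f x \<in> carrier (measure_cone X)"
      using f that by auto
    then have "finite_measure (f x)" "space (f x) = space X"
      using sets_eq_imp_space_eq[of "f x" X] by (auto simp: mem_carrier_measure_cone)
    then show ?thesis
      using finite_measure.bounded_measure[of "f x" U] by simp
  qed
  have cube: "(\<Oplus>\<^bsub>measure_cone X\<^esub>I\<in>odd_faces n. f (p I)) \<le>\<^bsub>measure_cone X\<^esub>
        (\<Oplus>\<^bsub>measure_cone X\<^esub>I\<in>even_faces n. f (p I)) \<longleftrightarrow>
      (\<forall>U\<in>sets X. (\<Sum>I\<in>odd_faces n. measure (f (p I)) U) \<le> (\<Sum>I\<in>even_faces n. measure (f (p I)) U))"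
    if p: "cone_cube P n p" for n p
  proof -
    have c: "I \<in> odd_faces n \<Longrightarrow> f (p I) \<in> carrier (measure_cone X)"
      "I \<in> even_faces n \<Longrightarrow> f (p I) \<in> carrier (measure_cone X)" for I
      using f cone_cube_faces[OF p] by auto
    show ?thesis
      using c by (simp add: measure_cone_le_iff finsum_measure_cone_closed
        measure_finsum_measure_cone finite_faces)
  qed
  have mono: "f x \<le>\<^bsub>measure_cone X\<^esub> f y \<longleftrightarrow> (\<forall>U\<in>sets X. measure (f x) U \<le> measure (f y) U)"
    if "x \<in> unit_ball P" "y \<in> unit_ball P" for x y
    using f that by (intro measure_cone_le_iff) auto
  \<comment> \<open>Monotonicity of \<open>f\<close> is assumed here because the setwise description
    of least upper bounds applies to non-decreasing sequences.\<close>
  have lub: "cone_lub (measure_cone X) (\<lambda>n. f (s n)) (f x) \<longleftrightarrow>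
      (\<forall>U\<in>sets X. (\<lambda>n. measure (f (s n)) U) \<longlonglongrightarrow> measure (f x) U)"
    if s: "cone_incseq P s" "range s \<subseteq> unit_ball P" "x \<in> unit_ball P"
      and m: "\<forall>x\<in>unit_ball P. \<forall>y\<in>unit_ball P. x \<le>\<^bsub>P\<^esub> y \<longrightarrow> f x \<le>\<^bsub>measure_cone X\<^esub> f y" for s x
  proof -
    have "cone_incseq (measure_cone X) (\<lambda>n. f (s n))"
      using s m f by (auto simp: cone_incseq_def image_subset_iff)
    then show ?thesis
      using s f by (subst cone_lub_measure_cone_iff) auto
  qed
  have path: "measurable_path (measure_cone X) n (\<lambda>r. f (\<eta> r)) \<longleftrightarrow>
      (\<forall>U\<in>sets X. (\<lambda>r. measure (f (\<eta> r)) U) \<in> borel_measurable (real_pow n))"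
    if "ball_path P n \<eta>" "\<exists>B. \<forall>x\<in>unit_ball P. measure (f x) (space X) \<le> B" for n \<eta>
    using that f ball_path_in_unit_ball[OF that(1)]
    unfolding measurable_path_measure_cone_iff by blast
  \<comment> \<open>A bound at the whole space serves for every measurable set, so the separate
    bounds for each \<open>U\<close> amount to a single one.\<close>
  have bounded: "(\<forall>U\<in>sets X. \<exists>B. \<forall>x\<in>unit_ball P. \<bar>measure (f x) U\<bar> \<le> B) \<longleftrightarrow>
      (\<exists>B. \<forall>x\<in>unit_ball P. measure (f x) (space X) \<le> B)"
  proof
    assume "\<forall>U\<in>sets X. \<exists>B. \<forall>x\<in>unit_ball P. \<bar>measure (f x) U\<bar> \<le> B"
    then show "\<exists>B. \<forall>x\<in>unit_ball P. measure (f x) (space X) \<le> B"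
      by (auto dest: bspec[OF _ sets.top])
  next
    assume "\<exists>B. \<forall>x\<in>unit_ball P. measure (f x) (space X) \<le> B"
    then obtain B where "\<And>x. x \<in> unit_ball P \<Longrightarrow> measure (f x) (space X) \<le> B" by blast
    then have "\<bar>measure (f x) U\<bar> \<le> B" if "x \<in> unit_ball P" "U \<in> sets X" for x U
      using finite_le[OF that] that(1) by force
    then show "\<forall>U\<in>sets X. \<exists>B. \<forall>x\<in>unit_ball P. \<bar>measure (f x) U\<bar> \<le> B"
      by blast
  qed
  show ?thesis
  proof
    assume st: "measurable_stable P (measure_cone X) f"
    then have st': "pre_stable P (measure_cone X) f"
      "\<exists>B. \<forall>x\<in>unit_ball P. measure (f x) (space X) \<le> B"
      "\<forall>x\<in>unit_ball P. \<forall>y\<in>unit_ball P. x \<le>\<^bsub>P\<^esub> y \<longrightarrow> f x \<le>\<^bsub>measure_cone X\<^esub> f y"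
      "preserves_lubs_on (unit_ball P) P (measure_cone X) f"
      "\<And>n \<eta>. ball_path P n \<eta> \<Longrightarrow> measurable_path (measure_cone X) n (\<lambda>r. f (\<eta> r))"
      by (auto simp: measurable_stable_def stable_def norm_measure_cone)
    have "scalar_stable P (\<lambda>x. measure (f x) U)" if U: "U \<in> sets X" for U
      unfolding scalar_stable_def
    proof (intro conjI allI impI ballI; (elim conjE)?)
      fix n p assume "1 \<le> n" "cone_cube P n p"
      then show "(\<Sum>I\<in>odd_faces n. measure (f (p I)) U) \<le> (\<Sum>I\<in>even_faces n. measure (f (p I)) U)"
        using st'(1) cube U unfolding pre_stable_iff by blast
    next
      show "\<exists>B. \<forall>x\<in>unit_ball P. \<bar>measure (f x) U\<bar> \<le> B"
        using st'(2) bounded U by blast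
    next
      fix x y assume "x \<in> unit_ball P" "y \<in> unit_ball P" "x \<le>\<^bsub>P\<^esub> y"
      then show "measure (f x) U \<le> measure (f y) U"
        using st'(3) mono U by blast
    next
      fix s x assume s: "cone_incseq P s" "range s \<subseteq> unit_ball P" "x \<in> unit_ball P" "cone_lub P s x"
      then have "cone_lub (measure_cone X) (\<lambda>n. f (s n)) (f x)"
        using st'(4) unfolding preserves_lubs_on_def by blast
      then show "(\<lambda>n. measure (f (s n)) U) \<longlonglongrightarrow> measure (f x) U"
        using lub[OF s(1-3) st'(3)] U by blast
    next
      fix n \<eta> assume "ball_path P n \<eta>"
      then show "(\<lambda>r. measure (f (\<eta> r)) U) \<in> borel_measurable (real_pow n)"
        using st'(5) path[OF _ st'(2)] U by blast
    qed
    then show "f \<in> unit_ball P \<rightarrow> carrier (measure_cone X) \<and>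
        (\<forall>U\<in>sets X. scalar_stable P (\<lambda>x. measure (f x) U))"
      using f by blast
  next
    assume "f \<in> unit_ball P \<rightarrow> carrier (measure_cone X) \<and>
        (\<forall>U\<in>sets X. scalar_stable P (\<lambda>x. measure (f x) U))"
    then have s: "\<And>U. U \<in> sets X \<Longrightarrow> scalar_stable P (\<lambda>x. measure (f x) U)" by blast
    have b: "\<exists>B. \<forall>x\<in>unit_ball P. measure (f x) (space X) \<le> B"
      using bounded scalar_stable_bounded[OF s] by blast
    have m: "\<forall>x\<in>unit_ball P. \<forall>y\<in>unit_ball P. x \<le>\<^bsub>P\<^esub> y \<longrightarrow> f x \<le>\<^bsub>measure_cone X\<^esub> f y"
      using mono scalar_stable_mono[OF s] by blast
    have "pre_stable P (measure_cone X) f"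
      unfolding pre_stable_iff using cube scalar_stable_cube[OF s] by blast
    moreover have "preserves_lubs_on (unit_ball P) P (measure_cone X) f"
      unfolding preserves_lubs_on_def using lub[OF _ _ _ m] scalar_stable_lub[OF s] by blast
    moreover have "measurable_path (measure_cone X) n (\<lambda>r. f (\<eta> r))" if "ball_path P n \<eta>" for n \<eta>
      using path[OF that b] scalar_stable_path[OF s that] by blast
    ultimately show "measurable_stable P (measure_cone X) f"
      using b m f by (auto simp: measurable_stable_def stable_def norm_measure_cone)
  qed
qed

section \<open>The cone of stable functions into finite measures\<close>

text \<open>The factor \<epsilon> of the definition can be cancelled, since scalar stability is
  invariant under positive scaling; conversely a bound on the total mass supplies it.\<close>

lemma mem_carrier_fun_cone:
  assumes "normed_cone P"
  shows "f \<in> carrier (stable_fun_cone P (measure_cone X)) \<longleftrightarrow>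
    f \<in> unit_ball P \<rightarrow>\<^sub>E carrier (measure_cone X) \<and>
    (\<forall>U\<in>sets X. scalar_stable P (\<lambda>y. measure (f y) U))" (is "?L \<longleftrightarrow> ?R")
proof
  assume L: ?L
  then obtain \<epsilon> where \<epsilon>: "0 < \<epsilon>"
    and st: "measurable_stable P (measure_cone X) (\<lambda>y. \<epsilon> \<odot>\<^bsub>measure_cone X\<^esub> f y)"
    by (auto simp: stable_fun_cone_def)
  have "scalar_stable P (\<lambda>y. measure (f y) U)" if U: "U \<in> sets X" for U
  proof -
    have "scalar_stable P (\<lambda>y. \<epsilon> * measure (f y) U)"
      using st U \<epsilon> unfolding measurable_stable_measure_cone_iff[OF assms]
      by (simp add: measure_smult_measure_cone)
    from scalar_stable_cmult[OF this, of "1 / \<epsilon>"] \<epsilon> show ?thesis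
      by simp
  qed
  then show ?R
    using L by (simp add: stable_fun_cone_def)
next
  assume R: ?R
  then obtain B where B: "\<And>y. y \<in> unit_ball P \<Longrightarrow> \<bar>measure (f y) (space X)\<bar> \<le> B"
    using scalar_stable_bounded[of P "\<lambda>y. measure (f y) (space X)"] by blast
  \<comment> \<open>Adding 1 keeps the denominator positive, and it dominates \<open>B\<close>, so
    the scaled values have mass at most 1.\<close>
  define \<epsilon> where "\<epsilon> = 1 / (1 + \<bar>B\<bar>)"
  have \<epsilon>: "0 < \<epsilon>" by (simp add: \<epsilon>_def add_pos_nonneg)
  have "measurable_stable P (measure_cone X) (\<lambda>y. \<epsilon> \<odot>\<^bsub>measure_cone X\<^esub> f y)"
    using R \<epsilon> unfolding measurable_stable_measure_cone_iff[OF assms]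
    by (auto simp: measure_smult_measure_cone intro!: smult_measure_cone_closed scalar_stable_cmult)
  moreover have "\<epsilon> \<odot>\<^bsub>measure_cone X\<^esub> f y \<in> unit_ball (measure_cone X)" if "y \<in> unit_ball P" for y
  proof -
    have "measure (f y) (space X) \<le> 1 + \<bar>B\<bar>"
      using B[OF that] by linarith
    then have "\<epsilon> * measure (f y) (space X) \<le> 1"
      by (simp add: \<epsilon>_def field_simps)
    then show ?thesis
      using R that \<epsilon>
      by (auto simp: unit_ball_def norm_measure_cone measure_smult_measure_cone
        intro!: smult_measure_cone_closed)
  qed
  ultimately show ?L
    using R \<epsilon> by (auto simp: stable_fun_cone_def)
qed

lemma fun_cone_apply_closed:
  assumes "f \<in> carrier (stable_fun_cone P (measure_cone X))" "y \<in> unit_ball P"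
  shows "f y \<in> carrier (measure_cone X)"
  using assms by (auto simp: stable_fun_cone_def)

lemma fun_cone_scalar_stable:
  assumes "normed_cone P" "f \<in> carrier (stable_fun_cone P (measure_cone X))" "U \<in> sets X"
  shows "scalar_stable P (\<lambda>y. measure (f y) U)"
  using assms by (auto simp: mem_carrier_fun_cone)

text \<open>Members of the carrier agree outside the ball by extensionality, so their values on
  measurable sets decide.\<close>

lemma fun_cone_eqI:
  assumes "f \<in> carrier (stable_fun_cone P (measure_cone X))"
    and "g \<in> carrier (stable_fun_cone P (measure_cone X))"
    and "\<And>y U. y \<in> unit_ball P \<Longrightarrow> U \<in> sets X \<Longrightarrow> measure (f y) U = measure (g y) U"
  shows "f = g"
proof (rule PiE_ext)
  show "f \<in> unit_ball P \<rightarrow>\<^sub>E carrier (measure_cone X)" "g \<in> unit_ball P \<rightarrow>\<^sub>E carrier (measure_cone X)"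
    using assms(1,2) by (auto simp: stable_fun_cone_def)
  show "f y = g y" if "y \<in> unit_ball P" for y
    using assms that by (intro measure_cone_eqI[where X = X] fun_cone_apply_closed)
qed

lemma measure_add_fun_cone:
  assumes "f \<in> carrier (stable_fun_cone P (measure_cone X))"
    and "g \<in> carrier (stable_fun_cone P (measure_cone X))"
    and "y \<in> unit_ball P" "U \<in> sets X"
  shows "measure ((f \<oplus>\<^bsub>stable_fun_cone P (measure_cone X)\<^esub> g) y) U = measure (f y) U + measure (g y) U"
  using assms fun_cone_apply_closed[OF assms(1,3)] fun_cone_apply_closed[OF assms(2,3)]
  by (simp add: stable_fun_cone_def measure_add_measure_cone)

lemma measure_smult_fun_cone:
  assumes "0 \<le> a" "y \<in> unit_ball P"
  shows "measure ((a \<odot>\<^bsub>stable_fun_cone P (measure_cone X)\<^esub> f) y) U = a * measure (f y) U"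
  using assms by (simp add: stable_fun_cone_def measure_smult_measure_cone)

lemma measure_zero_fun_cone:
  "y \<in> unit_ball P \<Longrightarrow> measure ((\<zero>\<^bsub>stable_fun_cone P (measure_cone X)\<^esub>) y) U = 0"
  by (simp add: stable_fun_cone_def measure_zero_measure_cone)

context
  fixes P :: "('a, 'm) measurable_cone_scheme" and X :: "'x measure"
  assumes P: "normed_cone P"
begin

lemma add_fun_cone_closed:
  assumes f: "f \<in> carrier (stable_fun_cone P (measure_cone X))"
    and g: "g \<in> carrier (stable_fun_cone P (measure_cone X))"
  shows "f \<oplus>\<^bsub>stable_fun_cone P (measure_cone X)\<^esub> g \<in> carrier (stable_fun_cone P (measure_cone X))"
  unfolding mem_carrier_fun_cone[OF P]
proof (intro conjI ballI)
  show "f \<oplus>\<^bsub>stable_fun_cone P (measure_cone X)\<^esub> g \<in> unit_ball P \<rightarrow>\<^sub>E carrier (measure_cone X)"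
    using fun_cone_apply_closed[OF f] fun_cone_apply_closed[OF g]
    by (auto simp: stable_fun_cone_def intro: add_measure_cone_closed)
next
  fix U assume U: "U \<in> sets X"
  show "scalar_stable P (\<lambda>y. measure ((f \<oplus>\<^bsub>stable_fun_cone P (measure_cone X)\<^esub> g) y) U)"
    using scalar_stable_add[OF fun_cone_scalar_stable[OF P f U] fun_cone_scalar_stable[OF P g U]]
    by (subst scalar_stable_cong[OF P measure_add_fun_cone[OF f g]]) (simp_all add: U)
qed

lemma smult_fun_cone_closed:
  assumes a: "0 \<le> a" and f: "f \<in> carrier (stable_fun_cone P (measure_cone X))"
  shows "a \<odot>\<^bsub>stable_fun_cone P (measure_cone X)\<^esub> f \<in> carrier (stable_fun_cone P (measure_cone X))"
  unfolding mem_carrier_fun_cone[OF P]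
proof (intro conjI ballI)
  show "a \<odot>\<^bsub>stable_fun_cone P (measure_cone X)\<^esub> f \<in> unit_ball P \<rightarrow>\<^sub>E carrier (measure_cone X)"
    using fun_cone_apply_closed[OF f]
    by (auto simp: stable_fun_cone_def intro: smult_measure_cone_closed)
next
  fix U assume U: "U \<in> sets X"
  show "scalar_stable P (\<lambda>y. measure ((a \<odot>\<^bsub>stable_fun_cone P (measure_cone X)\<^esub> f) y) U)"
    using scalar_stable_cmult[OF fun_cone_scalar_stable[OF P f U] a]
    by (subst scalar_stable_cong[OF P measure_smult_fun_cone[OF a]]) simp_all
qed

lemma zero_fun_cone_closed:
  "\<zero>\<^bsub>stable_fun_cone P (measure_cone X)\<^esub> \<in> carrier (stable_fun_cone P (measure_cone X))"
  unfolding mem_carrier_fun_cone[OF P]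
proof (intro conjI ballI)
  show "\<zero>\<^bsub>stable_fun_cone P (measure_cone X)\<^esub> \<in> unit_ball P \<rightarrow>\<^sub>E carrier (measure_cone X)"
    by (auto simp: stable_fun_cone_def zero_measure_cone_closed)
  show "scalar_stable P (\<lambda>y. measure (\<zero>\<^bsub>stable_fun_cone P (measure_cone X)\<^esub> y) U)" for U
    by (subst scalar_stable_cong[OF P measure_zero_fun_cone]) (simp_all add: scalar_stable_zero)
qed

lemma abelian_monoid_fun_cone: "abelian_monoid (stable_fun_cone P (measure_cone X))"
  by (rule abelian_monoidI)
     (auto intro!: fun_cone_eqI[where P = P and X = X]
       simp: add_fun_cone_closed zero_fun_cone_closed measure_add_fun_cone measure_zero_fun_cone)

text \<open>Pointwise domination makes the difference a measure at each \<open>y\<close>; scalar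
  stability of the difference puts it in the function cone, where the order demands its
  witness.\<close>

lemma fun_cone_le_iff:
  assumes f: "f \<in> carrier (stable_fun_cone P (measure_cone X))"
    and g: "g \<in> carrier (stable_fun_cone P (measure_cone X))"
  shows "f \<le>\<^bsub>stable_fun_cone P (measure_cone X)\<^esub> g \<longleftrightarrow>
    (\<forall>U\<in>sets X. (\<forall>y\<in>unit_ball P. measure (f y) U \<le> measure (g y) U) \<and>
      scalar_stable P (\<lambda>y. measure (g y) U - measure (f y) U))" (is "?L \<longleftrightarrow> ?R")
proof
  assume ?L
  then obtain h where h: "h \<in> carrier (stable_fun_cone P (measure_cone X))"
    and g_eq: "g = f \<oplus>\<^bsub>stable_fun_cone P (measure_cone X)\<^esub> h"
    unfolding cone_le_iff by blast
  have eq: "measure (g y) U = measure (f y) U + measure (h y) U" if "y \<in> unit_ball P" "U \<in> sets X" for y U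
    unfolding g_eq using measure_add_fun_cone[OF f h that] .
  show ?R
  proof (intro ballI conjI)
    fix U assume U: "U \<in> sets X"
    show "measure (f y) U \<le> measure (g y) U" if "y \<in> unit_ball P" for y
      using eq[OF that U] by simp
    show "scalar_stable P (\<lambda>y. measure (g y) U - measure (f y) U)"
      using fun_cone_scalar_stable[OF P h U]
      by (subst scalar_stable_cong[OF P, where g = "\<lambda>y. measure (h y) U"]) (simp_all add: eq U)
  qed
next
  assume R: ?R
  define h where "h = (\<lambda>y\<in>unit_ball P. diff_measure (g y) (f y))"
  have h_apply: "h y \<in> carrier (measure_cone X)"
      "\<And>U. U \<in> sets X \<Longrightarrow> measure (h y) U = measure (g y) U - measure (f y) U"
    if "y \<in> unit_ball P" for y
    using measure_cone_diff[OF fun_cone_apply_closed[OF f that] fun_cone_apply_closed[OF g that]] R that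
    by (auto simp: h_def)
  have "h \<in> carrier (stable_fun_cone P (measure_cone X))"
    unfolding mem_carrier_fun_cone[OF P]
  proof (intro conjI ballI)
    show "h \<in> unit_ball P \<rightarrow>\<^sub>E carrier (measure_cone X)"
      using h_apply(1) by (auto simp: h_def)
    show "scalar_stable P (\<lambda>y. measure (h y) U)" if "U \<in> sets X" for U
      using R that by (subst scalar_stable_cong[OF P h_apply(2)]) auto
  qed
  moreover from this have "g = f \<oplus>\<^bsub>stable_fun_cone P (measure_cone X)\<^esub> h"
    using f g
    by (intro fun_cone_eqI[OF g add_fun_cone_closed]) (simp_all add: measure_add_fun_cone h_apply)
  ultimately show ?L
    unfolding cone_le_iff by blast
qed

text \<open>A real supremum dominates its members when the family is bounded; the bound is scalar
  stability at the whole space.\<close>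

lemma measure_le_norm_fun_cone:
  assumes f: "f \<in> carrier (stable_fun_cone P (measure_cone X))" and y: "y \<in> unit_ball P"
  shows "measure (f y) (space X) \<le> cone_norm (stable_fun_cone P (measure_cone X)) f"
proof -
  obtain B where "\<And>y. y \<in> unit_ball P \<Longrightarrow> \<bar>measure (f y) (space X)\<bar> \<le> B"
    using scalar_stable_bounded[OF fun_cone_scalar_stable[OF P f sets.top]] by blast
  then have "bdd_above ((\<lambda>y. measure (f y) (space X)) ` unit_ball P)"
    by (intro bdd_aboveI2[where M = B]) force
  then show ?thesis
    using y by (auto simp: stable_fun_cone_def norm_measure_cone intro: cSUP_upper)
qed

lemma norm_fun_cone_le:
  assumes "\<And>y. y \<in> unit_ball P \<Longrightarrow> measure (f y) (space X) \<le> b"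
  shows "cone_norm (stable_fun_cone P (measure_cone X)) f \<le> b"
proof -
  \<comment> \<open>Bounding a real \<open>SUP\<close> from above requires a nonempty index
    set.\<close>
  have "unit_ball P \<noteq> {}"
    using normed_cone.zero_in_unit_ball[OF P] by blast
  then show ?thesis
    using assms by (auto simp: stable_fun_cone_def norm_measure_cone intro: cSUP_least)
qed

end

section \<open>Linear functions on the cone of finite measures\<close>

text \<open>The subsets of \<open>insert x A\<close> are those of \<open>A\<close> and their images
  under \<open>insert x\<close>, two disjoint families.\<close>

lemma sum_Pow_insert:
  assumes "finite A" "x \<notin> A"
  shows "(\<Sum>I\<in>Pow (insert x A). h I) = (\<Sum>I\<in>Pow A. h I + h (insert x I))"
proof -
  have "inj_on (insert x) (Pow A)"
    using assms(2) by (intro inj_onI) (auto simp: insert_ident)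
  then show ?thesis
    using assms unfolding Pow_insert
    by (subst sum.union_disjoint) (auto simp: sum.reindex sum.distrib)
qed

text \<open>Inserting a fixed element pairs off the subsets with opposite signs.\<close>

lemma sum_Pow_alternating:
  assumes "finite A" "A \<noteq> {}"
  shows "(\<Sum>I\<in>Pow A. (-1) ^ card I) = (0 :: 'a :: comm_ring_1)"
proof -
  obtain x B where A: "A = insert x B" "x \<notin> B" "finite B"
    using assms by (metis finite_insert mk_disjoint_insert ex_in_conv)
  have "(-1) ^ card I + (-1) ^ card (insert x I) = (0 :: 'a)" if "I \<in> Pow B" for I
    using that A finite_subset[of I B] by (subst card_insert_disjoint) auto
  then show ?thesis
    unfolding A(1) sum_Pow_insert[OF A(3,2)] by (simp add: sum.neutral)
qed

text \<open>The alternating sum of an affine function over a cube is its increment for \<open>n = 1\<close>,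
  and vanishes in higher dimension.\<close>

lemma affine_faces_le:
  fixes a :: real
  assumes n: "1 \<le> n" and b: "\<And>i. i \<in> {1..n} \<Longrightarrow> 0 \<le> b i"
  shows "(\<Sum>I\<in>odd_faces n. a + (\<Sum>i\<in>I. b i)) \<le> (\<Sum>I\<in>even_faces n. a + (\<Sum>i\<in>I. b i))"
proof -
  define c where "c I = a + (\<Sum>i\<in>I. b i)" for I
  \<comment> \<open>Truncated subtraction does no harm, as \<open>card I\<close> is at most
    \<open>n\<close>: the parities of \<open>n - card I\<close> and \<open>n + card I\<close>
    agree.\<close>
  have sgn: "(-1) ^ (n + card I) = (if even (n - card I) then 1 else - 1 :: real)" if "I \<subseteq> {1..n}" for I
    using card_mono[OF _ that] by (simp add: minus_one_power_iff)
  have "(\<Sum>I\<in>Pow {1..n}. (-1) ^ (n + card I) * c I) =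
      (\<Sum>I\<in>even_faces n \<union> odd_faces n. (-1) ^ (n + card I) * c I)"
    by (rule sum.cong) (auto simp: even_faces_def odd_faces_def)
  also have "\<dots> = (\<Sum>I\<in>even_faces n. (-1) ^ (n + card I) * c I) + (\<Sum>I\<in>odd_faces n. (-1) ^ (n + card I) * c I)"
    by (rule sum.union_disjoint) (auto simp: even_faces_def odd_faces_def)
  also have "\<dots> = (\<Sum>I\<in>even_faces n. c I) + (\<Sum>I\<in>odd_faces n. - c I)"
    by (intro arg_cong2[where f = "(+)"] sum.cong) (auto simp: even_faces_def odd_faces_def sgn)
  finally have diff: "(\<Sum>I\<in>even_faces n. c I) - (\<Sum>I\<in>odd_faces n. c I) =
      (\<Sum>I\<in>Pow {1..n}. (-1) ^ (n + card I) * c I)"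
    by (simp add: sum_negf)
  \<comment> \<open>Splitting off direction 1 pairs \<open>I\<close> with \<open>insert 1 I\<close>,
    whose signs are opposite and whose values differ by \<open>b 1\<close>; the common part
    cancels.\<close>
  have ins: "{1..n} = insert 1 {2..n}"
    using n by auto
  have "(\<Sum>I\<in>Pow {1..n}. (-1) ^ (n + card I) * c I) =
      (\<Sum>I\<in>Pow {2..n}. (-1) ^ (n + card I) * c I + (-1) ^ (n + card (insert 1 I)) * c (insert 1 I))"
    unfolding ins by (rule sum_Pow_insert) auto
  also have "\<dots> = (\<Sum>I\<in>Pow {2..n}. - ((-1) ^ n * b 1) * (-1) ^ card I)"
  proof (rule sum.cong)
    fix I assume "I \<in> Pow {2..n}"
    then have "finite I" "1 \<notin> I"
      using finite_subset[of I "{2..n}"] by auto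
    then show "(-1) ^ (n + card I) * c I + (-1) ^ (n + card (insert 1 I)) * c (insert 1 I) =
        - ((-1) ^ n * b 1) * (-1) ^ card I"
      by (simp add: c_def power_add algebra_simps)
  qed simp
  also have "\<dots> = - ((-1) ^ n * b 1) * (\<Sum>I\<in>Pow {2..n}. (-1) ^ card I)"
    by (simp add: sum_distrib_left)
  also have "\<dots> \<ge> 0"
  \<comment> \<open>For \<open>n = 1\<close> the set \<open>{2..n}\<close> is empty, its only subset
    contributes 1, and the expression equals \<open>b 1\<close>; otherwise the alternating sum
    vanishes.\<close>
  proof (cases "n = 1")
    case True
    then show ?thesis using b[of 1] by simp
  next
    case False
    then show ?thesis using n sum_Pow_alternating[of "{2..n}", where 'a = real] by simp
  qed
  finally show ?thesis
    using diff by (simp add: c_def)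
qed

text \<open>On each measurable set the mass of a vertex is affine in the set of directions, so
  \<open>affine_faces_le\<close> applies. The result is pre-stability of the identity.\<close>

lemma cone_cube_measure_cone_le:
  assumes n: "1 \<le> n" and p: "cone_cube (measure_cone X) n p"
  shows "(\<Oplus>\<^bsub>measure_cone X\<^esub>I\<in>odd_faces n. p I) \<le>\<^bsub>measure_cone X\<^esub> (\<Oplus>\<^bsub>measure_cone X\<^esub>I\<in>even_faces n. p I)"
proof -
  obtain u x where u: "u \<in> {1..n} \<rightarrow> carrier (measure_cone X)" and x: "x \<in> carrier (measure_cone X)"
    and p_eq: "p = (\<lambda>I. x \<oplus>\<^bsub>measure_cone X\<^esub> (\<Oplus>\<^bsub>measure_cone X\<^esub>i\<in>I. u i))"
    using p by (auto simp: cone_cube_def)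
  have *: "p I \<in> carrier (measure_cone X)"
      "\<And>U. U \<in> sets X \<Longrightarrow> measure (p I) U = measure x U + (\<Sum>i\<in>I. measure (u i) U)"
    if "I \<subseteq> {1..n}" for I
  proof -
    have I: "finite I" "\<And>i. i \<in> I \<Longrightarrow> u i \<in> carrier (measure_cone X)"
      using that u finite_subset[OF that] by auto
    note s = finsum_measure_cone[where f = u, OF I]
    show "p I \<in> carrier (measure_cone X)"
      unfolding p_eq using s x by (intro add_measure_cone_closed) auto
    show "measure (p I) U = measure x U + (\<Sum>i\<in>I. measure (u i) U)" if "U \<in> sets X" for U
      unfolding p_eq using s x that by (simp add: measure_add_measure_cone)
  qed
  show ?thesis
    using affine_faces_le[OF n]
    by (simp add: * faces_subset[of _ n, simplified] measure_cone_le_iff finsum_measure_cone_closed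
      measure_finsum_measure_cone finite_faces)
qed

section \<open>Linear maps and the cone order\<close>

lemma cone_linear_mono:
  assumes "cone_linear P Q f" "x \<in> carrier P" "x \<le>\<^bsub>P\<^esub> y"
  shows "f x \<le>\<^bsub>Q\<^esub> f y"
  using assms unfolding cone_linear_def cone_le_iff by (metis PiE)

text \<open>Preservation of zero settles the empty sum. It is a hypothesis of its own because
  abelian monoids carry no law for the scalar 0.\<close>

lemma cone_linear_finsum:
  assumes "abelian_monoid P" "abelian_monoid Q" and f: "cone_linear P Q f" "f \<zero>\<^bsub>P\<^esub> = \<zero>\<^bsub>Q\<^esub>"
    and "finite A" "\<And>i. i \<in> A \<Longrightarrow> g i \<in> carrier P"
  shows "f (\<Oplus>\<^bsub>P\<^esub>i\<in>A. g i) = (\<Oplus>\<^bsub>Q\<^esub>i\<in>A. f (g i))"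
proof -
  interpret P: abelian_monoid P by fact
  interpret Q: abelian_monoid Q by fact
  show ?thesis
    using assms(5,6)
  proof (induction rule: finite_induct)
    case (insert i A)
    then have "g \<in> A \<rightarrow> carrier P" "(\<lambda>i. f (g i)) \<in> A \<rightarrow> carrier Q" "f (g i) \<in> carrier Q"
      using f(1) by (auto simp: cone_linear_def)
    with insert f(1) show ?case
      by (simp add: P.finsum_insert Q.finsum_insert cone_linear_def)
  qed (use f in simp)
qed

text \<open>By linearity the two sums of images are the images of the two sums of vertices, and a
  linear map is monotone for the cone order.\<close>

lemma cone_linear_pre_stable:
  assumes "abelian_monoid Q" and f: "cone_linear (measure_cone X) Q f" "f \<zero>\<^bsub>measure_cone X\<^esub> = \<zero>\<^bsub>Q\<^esub>"
  shows "pre_stable (measure_cone X) Q f"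
  unfolding pre_stable_iff
proof (intro allI impI)
  fix n p assume n: "1 \<le> n" and p: "cone_cube (measure_cone X) n p"
  note c = normed_cone.cone_cube_faces[OF normed_cone_measure_cone p, THEN subsetD[OF unit_ball_subset]]
  note sum = cone_linear_finsum[OF abelian_monoid_measure_cone assms(1) f finite_faces(1) c(1)]
    cone_linear_finsum[OF abelian_monoid_measure_cone assms(1) f finite_faces(2) c(2)]
  show "(\<Oplus>\<^bsub>Q\<^esub>I\<in>odd_faces n. f (p I)) \<le>\<^bsub>Q\<^esub> (\<Oplus>\<^bsub>Q\<^esub>I\<in>even_faces n. f (p I))"
    using cone_linear_mono[OF f(1) finsum_measure_cone_closed[OF finite_faces(1) c(1)]
      cone_cube_measure_cone_le[OF n p]] by (simp add: sum)
qed

text \<open>Induction on the construction of nonnegative measurable functions; the values of the sum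
  measure enter only at indicators.\<close>

lemma nn_integral_add_measure_cone:
  assumes s: "sets \<mu> = sets X" "sets \<nu> = sets X" and f: "f \<in> borel_measurable X"
  shows "(\<integral>\<^sup>+x. f x \<partial>(\<mu> \<oplus>\<^bsub>measure_cone X\<^esub> \<nu>)) = (\<integral>\<^sup>+x. f x \<partial>\<mu>) + (\<integral>\<^sup>+x. f x \<partial>\<nu>)"
proof -
  note s' = s sets_add_measure_cone[of X \<mu> \<nu>]
  note [simp] = s'[THEN measurable_cong_sets[OF _ refl]] s'[THEN sets_eq_imp_space_eq] s'
  show ?thesis
    using f
  proof (induction rule: borel_measurable_induct)
    case (cong f g)
    then show ?case
      by (simp cong: nn_integral_cong_simp)
  next
    case (set A)
    then show ?case
      by (simp add: emeasure_add_measure_cone)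
  next
    case (mult u c)
    then show ?case
      by (simp add: nn_integral_cmult distrib_left)
  next
    case (add u v)
    then show ?case
      by (simp add: nn_integral_add algebra_simps)
  next
    case (seq F)
    \<comment> \<open>Monotonicity in \<open>i\<close> is what allows the supremum of the sums to
      split as a sum of suprema.\<close>
    have inc: "incseq (\<lambda>i. \<integral>\<^sup>+x. F i x \<partial>\<kappa>)" for \<kappa>
      using seq(3) by (auto simp: incseq_def le_fun_def intro!: nn_integral_mono)
    have "(\<integral>\<^sup>+x. (SUP i. F i x) \<partial>\<kappa>) = (SUP i. \<integral>\<^sup>+x. F i x \<partial>\<kappa>)" if "sets \<kappa> = sets X" for \<kappa>
      using seq that by (intro nn_integral_monotone_convergence_SUP)
        (auto simp: measurable_cong_sets[OF that refl])
    then show ?case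
      using seq by (simp add: ennreal_SUP_add[OF inc inc] image_comp)
  qed
qed

section \<open>Extension of a path along the Dirac measures\<close>

text \<open>A path of arity 1 is defined on functions with index set \<open>{..<1}\<close>; reading
  coordinate 0 presents it as a function \<gamma> of a real number.\<close>

locale stable_fun_path = measurable_cone P
  for P :: "('q, 'm) measurable_cone_scheme" (structure) +
  fixes X :: "'x measure" and \<gamma> :: "real \<Rightarrow> 'q \<Rightarrow> 'x measure"
  assumes path: "ball_path (stable_fun_cone P (measure_cone X)) 1 (\<lambda>v. \<gamma> (v 0))"
begin

abbreviation S where "S \<equiv> stable_fun_cone P (measure_cone X)"

lemma path_closed: "\<gamma> t \<in> carrier S"
  and path_norm_le: "cone_norm S (\<gamma> t) \<le> 1"
proof -
  \<comment> \<open>The point of \<open>real_pow 1\<close> with coordinate \<open>t\<close>, where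
    the path takes the value \<open>\<gamma> t\<close>.\<close>
  have "(\<lambda>i\<in>{..<1::nat}. t) \<in> space (real_pow 1)"
    by (auto simp: space_PiM)
  from ball_path_in_unit_ball[OF path this] show "\<gamma> t \<in> carrier S" "cone_norm S (\<gamma> t) \<le> 1"
    by (auto simp: unit_ball_def)
qed

lemma finite_measure_path:
  assumes "y \<in> unit_ball P"
  shows "finite_measure (\<gamma> t y)" "sets (\<gamma> t y) = sets X" "space (\<gamma> t y) = space X"
  using fun_cone_apply_closed[OF path_closed assms, of t] sets_eq_imp_space_eq[of "\<gamma> t y" X]
  by (auto simp: mem_carrier_measure_cone)

lemma measure_path_le:
  assumes "y \<in> unit_ball P"
  shows "measure (\<gamma> t y) U \<le> 1"
proof -
  have "measure (\<gamma> t y) U \<le> measure (\<gamma> t y) (space X)"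
    using finite_measure.bounded_measure[OF finite_measure_path(1)[OF assms], of t U]
    by (simp add: finite_measure_path(3)[OF assms])
  also have "\<dots> \<le> 1"
    using measure_le_norm_fun_cone[OF normed_cone_axioms path_closed assms, of t] path_norm_le[of t] by simp
  finally show ?thesis .
qed

text \<open>The tests of the function cone evaluate along a ball path \<eta> before testing, which
  gives measurability jointly in the argument and in the path parameter.\<close>

lemma path_joint_measurable:
  assumes \<eta>: "ball_path P n \<eta>" and U: "U \<in> sets X"
  shows "(\<lambda>(r, t). measure (\<gamma> t (\<eta> r)) U) \<in> borel_measurable (real_pow n \<Otimes>\<^sub>M borel)"
proof -
  have "(\<lambda>r f. measure (f (\<eta> r)) U) \<in> tests S n"
    unfolding stable_fun_cone_def measurable_cone.select_convs mem_Collect_eq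
    using \<eta> U by (intro exI[of _ \<eta>] exI[of _ "\<lambda>r \<mu>. measure \<mu> U"]) (auto simp: tests_measure_cone)
  moreover have "\<forall>k. \<forall>l\<in>tests S k.
      (\<lambda>(r, v). l r (\<gamma> (v 0))) \<in> borel_measurable (real_pow k \<Otimes>\<^sub>M real_pow 1)"
    using path by (simp add: ball_path_def measurable_path_def)
  ultimately have "(\<lambda>(r, v). measure (\<gamma> (v 0) (\<eta> r)) U) \<in> borel_measurable (real_pow n \<Otimes>\<^sub>M real_pow 1)"
    by (auto dest!: spec[of _ n] bspec[of _ _ "\<lambda>r f. measure (f (\<eta> r)) U"])
  \<comment> \<open>Embeds a real number as a point of \<open>real_pow 1\<close>, to replace the
    point \<open>v\<close> by a real variable.\<close>
  moreover have "(\<lambda>(r, t). (r, \<lambda>i\<in>{..<1::nat}. t)) \<in> real_pow n \<Otimes>\<^sub>M borel \<rightarrow>\<^sub>M real_pow n \<Otimes>\<^sub>M real_pow 1"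
    by measurable
  ultimately have "(\<lambda>x. (\<lambda>(r, v). measure (\<gamma> (v 0) (\<eta> r)) U) ((\<lambda>(r, t). (r, \<lambda>i\<in>{..<1::nat}. t)) x))
      \<in> borel_measurable (real_pow n \<Otimes>\<^sub>M borel)"
    by (rule measurable_compose[rotated])
  then show ?thesis
    by (simp add: case_prod_beta)
qed

text \<open>Constant paths turn joint measurability along paths into measurability at a fixed
  \<open>y\<close>.\<close>

lemma ball_path_const:
  assumes "y \<in> unit_ball P"
  shows "ball_path P n (\<lambda>_. y)"
proof -
  have "y \<in> carrier P"
    using assms by (simp add: unit_ball_def)
  then have "(\<lambda>(r, s). l r y) \<in> borel_measurable (real_pow k \<Otimes>\<^sub>M real_pow n)" if "l \<in> tests P k" for l k
    using measurable_compose[OF measurable_fst tests_measurable[OF that]] \<open>y \<in> carrier P\<close>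
    by (simp add: case_prod_beta')
  then show ?thesis
    using assms by (auto simp: ball_path_def measurable_path_def unit_ball_def)
qed

text \<open>A section of joint measurability for the constant path of arity 0, taken at the only
  point of \<open>real_pow 0\<close>.\<close>

lemma path_measurable:
  assumes "sets \<mu> = sets borel" "y \<in> unit_ball P" "U \<in> sets X"
  shows "(\<lambda>t. measure (\<gamma> t y) U) \<in> borel_measurable \<mu>"
  unfolding measurable_cong_sets[OF assms(1) refl]
  using measurable_Pair2[OF path_joint_measurable[OF ball_path_const[OF assms(2)] assms(3)],
      of "\<lambda>_. undefined" 0] by (simp add: space_PiM)

lemma path_measurable_emeasure:
  assumes "sets \<mu> = sets borel" "y \<in> unit_ball P" "U \<in> sets X"
  shows "(\<lambda>t. emeasure (\<gamma> t y) U) \<in> borel_measurable \<mu>"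
  using path_measurable[OF assms]
  by (simp add: finite_measure.emeasure_eq_measure[OF finite_measure_path(1)[OF assms(2)]])

text \<open>The nonnegative integral of \<open>emeasure\<close> needs no integrability, which makes
  countable additivity a matter of exchanging sum and integral. The restriction to the ball gives
  the extensionality demanded by the function cone.\<close>

definition extension :: "real measure \<Rightarrow> 'q \<Rightarrow> 'x measure" where
  "extension \<mu> = (\<lambda>y\<in>unit_ball P.
     measure_of (space X) (sets X) (\<lambda>U. \<integral>\<^sup>+t. emeasure (\<gamma> t y) U \<partial>\<mu>))"

lemma emeasure_extension:
  assumes \<mu>: "\<mu> \<in> carrier (measure_cone borel)" and y: "y \<in> unit_ball P" and U: "U \<in> sets X"
  shows "emeasure (extension \<mu> y) U = (\<integral>\<^sup>+t. emeasure (\<gamma> t y) U \<partial>\<mu>)"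
proof -
  have s: "sets \<mu> = sets borel"
    using \<mu> by (simp add: mem_carrier_measure_cone)
  have "countably_additive (sets X) (\<lambda>U. \<integral>\<^sup>+t. emeasure (\<gamma> t y) U \<partial>\<mu>)"
  proof (rule countably_additiveI)
    fix A :: "nat \<Rightarrow> _"
    assume A: "range A \<subseteq> sets X" "disjoint_family A"
    have "(\<Sum>i. \<integral>\<^sup>+t. emeasure (\<gamma> t y) (A i) \<partial>\<mu>) = (\<integral>\<^sup>+t. (\<Sum>i. emeasure (\<gamma> t y) (A i)) \<partial>\<mu>)"
    proof (intro nn_integral_suminf[symmetric])
      show "(\<lambda>t. emeasure (\<gamma> t y) (A i)) \<in> borel_measurable \<mu>" for i
        using A by (intro path_measurable_emeasure[OF s y]) auto
    qed
    also have "\<dots> = (\<integral>\<^sup>+t. emeasure (\<gamma> t y) (\<Union>i. A i) \<partial>\<mu>)"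
      using A by (intro nn_integral_cong suminf_emeasure) (auto simp: finite_measure_path(2)[OF y])
    finally show "(\<Sum>i. \<integral>\<^sup>+t. emeasure (\<gamma> t y) (A i) \<partial>\<mu>) = (\<integral>\<^sup>+t. emeasure (\<gamma> t y) (\<Union>i. A i) \<partial>\<mu>)" .
  qed
  then show ?thesis
    using y U by (simp add: extension_def emeasure_measure_of_sigma positive_def sets.sigma_algebra_axioms)
qed

text \<open>The Bochner form over real-valued integrands, to which
  \<open>scalar_stable_integral\<close> applies.\<close>

lemma measure_extension:
  assumes \<mu>: "\<mu> \<in> carrier (measure_cone borel)" and y: "y \<in> unit_ball P" and U: "U \<in> sets X"
  shows "measure (extension \<mu> y) U = (\<integral>t. measure (\<gamma> t y) U \<partial>\<mu>)"
proof -
  have "(\<lambda>t. measure (\<gamma> t y) U) \<in> borel_measurable \<mu>"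
    using \<mu> by (intro path_measurable[OF _ y U]) (simp add: mem_carrier_measure_cone)
  then show ?thesis
    unfolding measure_def[of "extension \<mu> y"] emeasure_extension[OF assms]
    by (simp add: finite_measure.emeasure_eq_measure[OF finite_measure_path(1)[OF y]]
      integral_eq_nn_integral)
qed

text \<open>The integrand is at most 1 because \<gamma> takes values in the unit ball. This one
  estimate yields the norm bound, the value at the zero measure and convergence along increasing
  sequences.\<close>

lemma measure_extension_le:
  assumes \<mu>: "\<mu> \<in> carrier (measure_cone borel)" and y: "y \<in> unit_ball P" and U: "U \<in> sets X"
  shows "measure (extension \<mu> y) U \<le> measure \<mu> UNIV"
proof -
  interpret finite_measure \<mu> using \<mu> by (simp add: mem_carrier_measure_cone)
  have s: "sets \<mu> = sets borel" "space \<mu> = UNIV"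
    using \<mu> sets_eq_imp_space_eq[of \<mu> borel] by (auto simp: mem_carrier_measure_cone)
  have "integrable \<mu> (\<lambda>t. measure (\<gamma> t y) U)"
    using measure_path_le[OF y]
    by (intro integrable_const_bound[where B = 1] path_measurable[OF s(1) y U]) simp
  then have "(\<integral>t. measure (\<gamma> t y) U \<partial>\<mu>) \<le> (\<integral>t. 1 \<partial>\<mu>)"
    using measure_path_le[OF y] by (intro integral_mono) auto
  then show ?thesis
    by (simp add: measure_extension[OF assms] s)
qed

text \<open>Stability in \<open>y\<close> for fixed \<mu> is integrated from the stability of each
  \<open>\<gamma> t\<close>, with dominating constant 1.\<close>

lemma extension_closed:
  assumes \<mu>: "\<mu> \<in> carrier (measure_cone borel)"
  shows "extension \<mu> \<in> carrier S"
  unfolding mem_carrier_fun_cone[OF normed_cone_axioms]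
proof (intro conjI ballI)
  have s: "sets \<mu> = sets borel" "finite_measure \<mu>"
    using \<mu> by (auto simp: mem_carrier_measure_cone)
  have "extension \<mu> y \<in> carrier (measure_cone X)" if y: "y \<in> unit_ball P" for y
  proof -
    have st: "sets (extension \<mu> y) = sets X" "space (extension \<mu> y) = space X"
      using y by (auto simp: extension_def)
    have "emeasure (extension \<mu> y) (space X) \<le> (\<integral>\<^sup>+t. 1 \<partial>\<mu>)"
      unfolding emeasure_extension[OF \<mu> y sets.top] using measure_path_le[OF y]
      by (intro nn_integral_mono)
         (simp add: finite_measure.emeasure_eq_measure[OF finite_measure_path(1)[OF y]])
    also have "\<dots> < \<infinity>"
      using finite_measure.emeasure_finite[OF s(2)] by (simp add: less_top)
    finally show ?thesis
      using st by (auto simp: mem_carrier_measure_cone intro!: finite_measureI)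
  qed
  then show "extension \<mu> \<in> unit_ball P \<rightarrow>\<^sub>E carrier (measure_cone X)"
    by (auto simp: extension_def)
next
  fix U assume U: "U \<in> sets X"
  have s: "sets \<mu> = sets borel" "finite_measure \<mu>"
    using \<mu> by (auto simp: mem_carrier_measure_cone)
  have "scalar_stable P (\<lambda>y. \<integral>t. measure (\<gamma> t y) U \<partial>\<mu>)"
  proof (rule scalar_stable_integral[OF normed_cone_axioms s(2), where B = 1])
    show "(\<lambda>(r, t). measure (\<gamma> t (\<eta> r)) U) \<in> borel_measurable (real_pow n \<Otimes>\<^sub>M \<mu>)"
      if "ball_path P n \<eta>" for n \<eta>
      using path_joint_measurable[OF that U]
      by (simp add: measurable_cong_sets[OF sets_pair_measure_cong[OF refl s(1)] refl])
  qed (use path_measurable[OF s(1) _ U] measure_path_le fun_cone_scalar_stable[OF normed_cone_axioms path_closed U] in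
      auto)
  then show "scalar_stable P (\<lambda>y. measure (extension \<mu> y) U)"
    by (subst scalar_stable_cong[OF normed_cone_axioms measure_extension[OF \<mu> _ U]])
qed

lemma norm_extension_le:
  assumes "\<mu> \<in> carrier (measure_cone borel)"
  shows "cone_norm S (extension \<mu>) \<le> measure \<mu> UNIV"
  using measure_extension_le[OF assms] by (intro norm_fun_cone_le[OF normed_cone_axioms]) auto

section \<open>Linearity of the extension and its values at Dirac measures\<close>

lemma measure_extension_add:
  assumes "\<mu> \<in> carrier (measure_cone borel)" "\<nu> \<in> carrier (measure_cone borel)"
    and y: "y \<in> unit_ball P" and U: "U \<in> sets X"
  shows "measure (extension (\<mu> \<oplus>\<^bsub>measure_cone borel\<^esub> \<nu>) y) U =
    measure (extension \<mu> y) U + measure (extension \<nu> y) U"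
proof -
  have s: "sets \<mu> = sets borel" "sets \<nu> = sets borel"
    using assms by (auto simp: mem_carrier_measure_cone)
  have f: "finite_measure (extension \<kappa> y)" if "\<kappa> \<in> carrier (measure_cone borel)" for \<kappa>
    using fun_cone_apply_closed[OF extension_closed[OF that] y] by (simp add: mem_carrier_measure_cone)
  \<comment> \<open>Additivity is proved for \<open>emeasure\<close>, where the integral against a
    sum of measures splits without integrability conditions, and is then transferred by
    finiteness.\<close>
  have "emeasure (extension (\<mu> \<oplus>\<^bsub>measure_cone borel\<^esub> \<nu>) y) U =
      emeasure (extension \<mu> y) U + emeasure (extension \<nu> y) U"
    using assms by (simp add: emeasure_extension add_measure_cone_closed
      nn_integral_add_measure_cone[OF s] path_measurable_emeasure)
  then show ?thesis
    using assms(1,2)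
    by (simp add: finite_measure.emeasure_eq_measure[OF f] add_measure_cone_closed flip: ennreal_plus)
qed

lemma extension_linear: "cone_linear (measure_cone borel) S extension"
  unfolding cone_linear_def
proof (intro conjI ballI allI impI)
  show "extension \<in> carrier (measure_cone borel) \<rightarrow> carrier S"
    using extension_closed by blast
next
  fix \<mu> \<nu> :: "real measure"
  assume "\<mu> \<in> carrier (measure_cone borel)" "\<nu> \<in> carrier (measure_cone borel)"
  then show "extension (\<mu> \<oplus>\<^bsub>measure_cone borel\<^esub> \<nu>) = extension \<mu> \<oplus>\<^bsub>S\<^esub> extension \<nu>"
    by (intro fun_cone_eqI[where P = P and X = X])
       (simp_all add: measure_extension_add measure_add_fun_cone extension_closed
         add_measure_cone_closed add_fun_cone_closed[OF normed_cone_axioms])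
next
  fix a :: real and \<mu> :: "real measure"
  assume a: "0 \<le> a" and \<mu>: "\<mu> \<in> carrier (measure_cone borel)"
  have s: "sets \<mu> = sets borel"
    using \<mu> by (simp add: mem_carrier_measure_cone)
  have "measure (extension (a \<odot>\<^bsub>measure_cone borel\<^esub> \<mu>) y) U = a * measure (extension \<mu> y) U"
    if y: "y \<in> unit_ball P" and U: "U \<in> sets X" for y U
  proof -
    have "emeasure (extension (a \<odot>\<^bsub>measure_cone borel\<^esub> \<mu>) y) U = ennreal a * emeasure (extension \<mu> y) U"
      by (simp only: emeasure_extension smult_measure_cone_closed \<mu> y U)
         (simp only: smult_measure_cone nn_integral_scale_measure path_measurable_emeasure[OF s y U])
    then show ?thesis
      using a by (simp add: measure_def enn2real_mult)
  qed
  with a \<mu> show "extension (a \<odot>\<^bsub>measure_cone borel\<^esub> \<mu>) = a \<odot>\<^bsub>S\<^esub> extension \<mu>"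
    by (intro fun_cone_eqI[where P = P and X = X])
       (simp_all add: measure_smult_fun_cone extension_closed smult_measure_cone_closed
         smult_fun_cone_closed[OF normed_cone_axioms])
qed

text \<open>The total mass of the zero measure bounds all values from above by 0.\<close>

lemma extension_zero: "extension \<zero>\<^bsub>measure_cone borel\<^esub> = \<zero>\<^bsub>S\<^esub>"
proof (rule fun_cone_eqI[OF extension_closed[OF zero_measure_cone_closed] zero_fun_cone_closed[OF normed_cone_axioms]])
  fix y U assume "y \<in> unit_ball P" "U \<in> sets X"
  then show "measure (extension \<zero>\<^bsub>measure_cone borel\<^esub> y) U = measure (\<zero>\<^bsub>S\<^esub> y) U"
    using measure_extension_le[OF zero_measure_cone_closed, of y U]
      measure_nonneg[of "extension \<zero>\<^bsub>measure_cone borel\<^esub> y" U]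
    unfolding measure_zero_measure_cone by (simp add: measure_zero_fun_cone)
qed

lemma extension_return: "extension (return borel t) = \<gamma> t"
proof (rule fun_cone_eqI[OF extension_closed path_closed])
  interpret prob_space "return borel t" by (rule prob_space_return) simp
  show r: "return borel t \<in> carrier (measure_cone borel)"
    by (simp add: mem_carrier_measure_cone finite_measure_axioms)
  fix y U assume y: "y \<in> unit_ball P" and U: "U \<in> sets X"
  show "measure (extension (return borel t) y) U = measure (\<gamma> t y) U"
    unfolding measure_extension[OF r y U] by (rule integral_return) (simp_all add: path_measurable[OF refl y U])
qed

text \<open>
  The remainders \<open>\<mu> - s n\<close> of an increasing sequence with least upper bound \<open>\<mu>\<close> have total mass
  tending to zero.
\<close>

lemma extension_tendsto:
  assumes s: "cone_incseq (measure_cone borel) s" and lub: "cone_lub (measure_cone borel) s \<mu>"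
    and y: "y \<in> unit_ball P" and U: "U \<in> sets X"
  shows "(\<lambda>n. measure (extension (s n) y) U) \<longlonglongrightarrow> measure (extension \<mu> y) U"
proof -
  have c: "s n \<in> carrier (measure_cone borel)" for n
    using s by (auto simp: cone_incseq_def)
  have \<mu>: "\<mu> \<in> carrier (measure_cone borel)"
    and lim: "(\<lambda>n. measure (s n) UNIV) \<longlonglongrightarrow> measure \<mu> UNIV"
    using lub cone_lub_measure_cone_iff[OF s] by auto
  \<comment> \<open>A least upper bound is in particular an upper bound, and the cone order supplies
    the remainders as actual measures.\<close>
  have "\<exists>\<kappa>\<in>carrier (measure_cone borel). \<mu> = s n \<oplus>\<^bsub>measure_cone borel\<^esub> \<kappa>" for n
    using lub c cone_lub_iff[of s "measure_cone borel"] unfolding cone_le_iff by blast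
  then obtain \<kappa> where \<kappa>: "\<And>n. \<kappa> n \<in> carrier (measure_cone borel)"
      "\<And>n. \<mu> = s n \<oplus>\<^bsub>measure_cone borel\<^esub> \<kappa> n"
    by metis
  have mass: "measure (\<kappa> n) UNIV = measure \<mu> UNIV - measure (s n) UNIV" for n
    using measure_add_measure_cone[OF c[of n] \<kappa>(1)[of n], of UNIV] \<kappa>(2)[of n] by simp
  have e: "measure (extension (s n) y) U = measure (extension \<mu> y) U - measure (extension (\<kappa> n) y) U" for n
    using measure_extension_add[OF c[of n] \<kappa>(1)[of n] y U] \<kappa>(2)[of n] by simp
  have "(\<lambda>n. measure (\<kappa> n) UNIV) \<longlonglongrightarrow> measure \<mu> UNIV - measure \<mu> UNIV"
    unfolding mass by (intro tendsto_diff tendsto_const lim)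
  then have "(\<lambda>n. measure (\<kappa> n) UNIV) \<longlonglongrightarrow> 0" by simp
  \<comment> \<open>Each such value lies between 0 and the mass of the remainder.\<close>
  then have "(\<lambda>n. measure (extension (\<kappa> n) y) U) \<longlonglongrightarrow> 0"
    by (rule Lim_null_comparison[rotated]) (simp add: measure_extension_le \<kappa>(1) y U)
  then have "(\<lambda>n. measure (extension (s n) y) U) \<longlonglongrightarrow> measure (extension \<mu> y) U - 0"
    unfolding e by (intro tendsto_diff tendsto_const)
  then show ?thesis by simp
qed

text \<open>Pointwise convergence does not suffice for leastness: the difference to an arbitrary
  upper bound \<open>g\<close> must be stable again, which is where
  \<open>scalar_stable_diff_limit\<close> enters.\<close>

lemma extension_lub:
  assumes s: "cone_incseq (measure_cone borel) s" and lub: "cone_lub (measure_cone borel) s \<mu>"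
  shows "cone_lub S (\<lambda>n. extension (s n)) (extension \<mu>)"
proof -
  have c: "s n \<in> carrier (measure_cone borel)" for n
    using s by (auto simp: cone_incseq_def)
  have \<mu>: "\<mu> \<in> carrier (measure_cone borel)" and le: "s n \<le>\<^bsub>measure_cone borel\<^esub> \<mu>" for n
    using lub c cone_lub_iff[of s "measure_cone borel"] by auto
  have r: "range (\<lambda>n. extension (s n)) \<subseteq> carrier S"
    using extension_closed c by auto
  show ?thesis
    unfolding cone_lub_iff[OF r]
  proof (intro conjI allI ballI impI)
    show "extension \<mu> \<in> carrier S"
      by (rule extension_closed[OF \<mu>])
    show "extension (s n) \<le>\<^bsub>S\<^esub> extension \<mu>" for n
      by (rule cone_linear_mono[OF extension_linear c le])
  next
    fix g assume g: "g \<in> carrier S" and "\<forall>n. extension (s n) \<le>\<^bsub>S\<^esub> g"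
    then have ub: "y \<in> unit_ball P \<Longrightarrow> measure (extension (s n) y) U \<le> measure (g y) U"
        "scalar_stable P (\<lambda>y. measure (g y) U - measure (extension (s n) y) U)"
      if "U \<in> sets X" for n y U
      using that by (auto simp: fun_cone_le_iff[OF normed_cone_axioms extension_closed[OF c] g])
    show "extension \<mu> \<le>\<^bsub>S\<^esub> g"
      unfolding fun_cone_le_iff[OF normed_cone_axioms extension_closed[OF \<mu>] g]
    proof (intro ballI conjI)
      fix U assume U: "U \<in> sets X"
      show "measure (extension \<mu> y) U \<le> measure (g y) U" if "y \<in> unit_ball P" for y
        using ub(1)[OF U that] by (intro LIMSEQ_le_const2[OF extension_tendsto[OF s lub that U]]) auto
      show "scalar_stable P (\<lambda>y. measure (g y) U - measure (extension \<mu> y) U)"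
        by (rule scalar_stable_diff_limit[OF normed_cone_axioms fun_cone_scalar_stable[OF normed_cone_axioms g U]
              fun_cone_scalar_stable[OF normed_cone_axioms extension_closed[OF \<mu>] U],
              where h = "\<lambda>n y. measure (g y) U - measure (extension (s n) y) U"])
           (intro ub(2) tendsto_diff tendsto_const extension_tendsto[OF s lub _ U] U; assumption)+
    qed
  qed
qed

text \<open>A path of measures in the unit ball is a kernel of subprobability measures, so
  integrating a jointly measurable function against it is measurable in the parameters.\<close>

lemma extension_path:
  assumes \<kappa>: "ball_path (measure_cone borel) n \<kappa>"
  shows "measurable_path S n (\<lambda>r. extension (\<kappa> r))"
proof -
  have c: "\<kappa> r \<in> carrier (measure_cone borel)" and b: "measure (\<kappa> r) UNIV \<le> 1"
    if "r \<in> space (real_pow n)" for r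
    using ball_path_in_unit_ball[OF \<kappa> that] by (auto simp: unit_ball_def norm_measure_cone)
  have "(\<lambda>r. emeasure (\<kappa> r) A) \<in> borel_measurable (real_pow n)" if "A \<in> sets borel" for A
  proof -
    have "(\<lambda>r. measure (\<kappa> r) A) \<in> borel_measurable (real_pow n)"
      using \<kappa> that unfolding ball_path_def measurable_path_measure_cone_iff by blast
    then have "(\<lambda>r. ennreal (measure (\<kappa> r) A)) \<in> borel_measurable (real_pow n)"
      by measurable
    then show ?thesis
      using c by (subst measurable_cong[where g = "\<lambda>r. ennreal (measure (\<kappa> r) A)"])
        (auto simp: mem_carrier_measure_cone finite_measure.emeasure_eq_measure)
  qed
  moreover have "subprob_space (\<kappa> r)" if "r \<in> space (real_pow n)" for r
  proof -
    have "finite_measure (\<kappa> r)" "space (\<kappa> r) = UNIV"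
      using c[OF that] sets_eq_imp_space_eq[of "\<kappa> r" borel] by (auto simp: mem_carrier_measure_cone)
    then show ?thesis
      using b[OF that] by (intro subprob_spaceI) (auto simp: finite_measure.emeasure_eq_measure)
  qed
  ultimately have kernel: "\<kappa> \<in> real_pow n \<rightarrow>\<^sub>M subprob_algebra borel"
    using c by (intro measurable_subprob_algebra) (auto simp: mem_carrier_measure_cone)
  have "(\<lambda>(r, s). measure (extension (\<kappa> s) (\<eta> r)) U) \<in> borel_measurable (real_pow k \<Otimes>\<^sub>M real_pow n)"
    if \<eta>: "ball_path P k \<eta>" and U: "U \<in> sets X" for k \<eta> U
  proof -
    \<comment> \<open>Makes the integrand a function of both parameters and \<open>t\<close>, as the
      kernel lemma requires; its values depend only on the first parameter and \<open>t\<close>,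
      while the kernel depends on the second parameter.\<close>
    have "(\<lambda>p. (fst (fst p), snd p)) \<in> (real_pow k \<Otimes>\<^sub>M real_pow n) \<Otimes>\<^sub>M borel \<rightarrow>\<^sub>M real_pow k \<Otimes>\<^sub>M (borel :: real measure)"
      by measurable
    from measurable_compose[OF this path_joint_measurable[OF \<eta> U]]
    have "(\<lambda>(x, t). ennreal (measure (\<gamma> t (\<eta> (fst x))) U)) \<in>
        borel_measurable ((real_pow k \<Otimes>\<^sub>M real_pow n) \<Otimes>\<^sub>M borel)"
      by (simp add: case_prod_beta)
    from nn_integral_measurable_subprob_algebra2[OF this measurable_compose[OF measurable_snd kernel]]
    have "(\<lambda>x. enn2real (\<integral>\<^sup>+t. ennreal (measure (\<gamma> t (\<eta> (fst x))) U) \<partial>\<kappa> (snd x)))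
        \<in> borel_measurable (real_pow k \<Otimes>\<^sub>M real_pow n)"
      by measurable
    \<comment> \<open>\<open>measure\<close> is \<open>enn2real\<close> of \<open>emeasure\<close>,
      and the latter is the nonnegative integral.\<close>
    moreover have "(\<lambda>(r, s). measure (extension (\<kappa> s) (\<eta> r)) U) x =
        enn2real (\<integral>\<^sup>+t. ennreal (measure (\<gamma> t (\<eta> (fst x))) U) \<partial>\<kappa> (snd x))"
      if "x \<in> space (real_pow k \<Otimes>\<^sub>M real_pow n)" for x
    proof -
      have "\<eta> (fst x) \<in> unit_ball P" "\<kappa> (snd x) \<in> carrier (measure_cone borel)"
        using that ball_path_in_unit_ball[OF \<eta>] c by (auto simp: space_pair_measure)
      then show ?thesis
        by (simp add: case_prod_beta measure_def[of "extension _ _"] emeasure_extension U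
          finite_measure.emeasure_eq_measure finite_measure_path)
    qed
    ultimately show ?thesis
      by (subst measurable_cong) auto
  qed
  \<comment> \<open>Every test of this function cone is given by a ball path and a measurable set,
    so the case just treated is general.\<close>
  then have "(\<lambda>(r, s). l r (extension (\<kappa> s))) \<in> borel_measurable (real_pow k \<Otimes>\<^sub>M real_pow n)"
    if "l \<in> tests S k" for l k
    using that by (auto simp: stable_fun_cone_def tests_measure_cone)
  moreover have "cone_norm S (extension (\<kappa> r)) \<le> 1" if "r \<in> space (real_pow n)" for r
    using norm_extension_le[OF c[OF that]] b[OF that] by simp
  ultimately show ?thesis
    using c extension_closed by (auto simp: measurable_path_def)
qed

text \<open>On the unit ball the norm estimate gives the bound 1, and the least-upper-bound clause
  specialises a fact about arbitrary increasing sequences.\<close>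

lemma extension_measurable_stable: "measurable_stable (measure_cone borel) S extension"
proof -
  have "extension \<in> unit_ball (measure_cone borel) \<rightarrow> carrier S"
    using extension_closed by (auto simp: unit_ball_def)
  moreover have "pre_stable (measure_cone borel) S extension"
    by (rule cone_linear_pre_stable[OF abelian_monoid_fun_cone[OF normed_cone_axioms] extension_linear extension_zero])
  moreover have "cone_norm S (extension \<mu>) \<le> 1" if "\<mu> \<in> unit_ball (measure_cone borel)" for \<mu>
    using that norm_extension_le[of \<mu>] by (auto simp: unit_ball_def norm_measure_cone)
  moreover have "extension \<mu> \<le>\<^bsub>S\<^esub> extension \<nu>"
    if "\<mu> \<in> unit_ball (measure_cone borel)" "\<mu> \<le>\<^bsub>measure_cone borel\<^esub> \<nu>" for \<mu> \<nu>
    using that by (intro cone_linear_mono[OF extension_linear]) (auto simp: unit_ball_def)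
  moreover have "preserves_lubs_on (unit_ball (measure_cone borel)) (measure_cone borel) S extension"
    unfolding preserves_lubs_on_def using extension_lub by blast
  ultimately show ?thesis
    unfolding measurable_stable_def stable_def using extension_path by blast
qed

end

theorem theorem6p11:
  fixes Q :: "'q measurable_cone" and X :: "'x measure" and \<gamma> :: "real \<Rightarrow> 'q \<Rightarrow> 'x measure"
  assumes "measurable_cone Q" and "complete_cone Q"
    and "ball_path (stable_fun_cone Q (measure_cone X)) 1 (\<lambda>v. \<gamma> (v 0))"
  shows "\<exists>\<gamma>_hat :: real measure \<Rightarrow> 'q \<Rightarrow> 'x measure.
    measurable_stable (measure_cone borel) (stable_fun_cone Q (measure_cone X)) \<gamma>_hat \<and>
    cone_linear (measure_cone borel) (stable_fun_cone Q (measure_cone X)) \<gamma>_hat \<and>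
    (\<forall>r. \<gamma>_hat (return borel r) = \<gamma> r) \<and>
    (\<forall>\<mu>\<in>carrier (measure_cone borel). \<forall>y\<in>unit_ball Q. \<forall>U\<in>sets X.
       emeasure (\<gamma>_hat \<mu> y) U = (\<integral>\<^sup>+ r. emeasure (\<gamma> r y) U \<partial>\<mu>))"
proof -
  interpret stable_fun_path Q X \<gamma>
    using assms(1,3) by (simp add: stable_fun_path_def stable_fun_path_axioms_def)
  show ?thesis
    using extension_measurable_stable extension_linear extension_return emeasure_extension by blast
qed

end
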